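(* Let $\mathcal{A}$ be a ribbon combinatory algebra. Then its internal PROB $\mathcal{I}_{\mathcal{A}}$ is a ribbon category (with braid $\boldsymbol{\sigma}$ and twist $\boldsymbol{\theta}$), and $\mathcal{A}$ is isomorphic, as a ribbon combinatory algebra, to the ribbon combinatory algebra arising from a reflexive object of the ribbon category $\mathcal{I}_{\mathcal{A}}$ (namely the object $1$, with a suitable choice of left dual and isomorphism $\varphi$).
   Context: Applicative structure: a set with a left-associative binary application $a\,b$. For elements $\mathbf{B},\mathbf{I}$ write $a\circ b:=\mathbf{B}\,a\,b$, $a^0:=\mathbf{I}$, $a^{n+1}:=a\circ a^n$. A ribbon combinatory algebra is an applicative structure with elements $\mathbf{B},\mathbf{C}^+,\mathbf{C}^-,\mathbf{I},\boldsymbol{\theta}^+,\boldsymbol{\theta}^-,\mathbf{Tr}$ such that for all $a,b,c$ (each $\star$ ranging independently over $\{+,-\}$; $\pm/\mp$ linked, required for both choices): $\mathbf{B}\,a\,b\,c=a\,(b\,c)$; $\mathbf{C}^\star\,a\,b\,c=a\,c\,b$; $\mathbf{I}\,a=a$; $\mathbf{C}^+\,a\,b=\mathbf{C}^-\,a\,b$; $\mathbf{B}\,\mathbf{I}=\mathbf{I}$; $\mathbf{C}^\star\,\mathbf{B}\,\mathbf{I}=\mathbf{B}\,\mathbf{I}$; $(\mathbf{C}^\star\,\mathbf{B}\,\mathbf{B})\circ(\mathbf{B}\circ\mathbf{B})=(\mathbf{B}\,\mathbf{B})\circ\mathbf{B}$; $\mathbf{C}^\pm\circ\mathbf{C}^\mp=\mathbf{B}\,(\mathbf{B}\,\mathbf{I})$;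 $(\mathbf{C}^\star\,\mathbf{B}\,\mathbf{C}^\pm)\circ(\mathbf{B}\circ\mathbf{B})=(\mathbf{B}\,\mathbf{C}^\pm)\circ(\mathbf{B}\circ\mathbf{B})$; $(\mathbf{B}\,\mathbf{C}^\pm)\circ(\mathbf{C}^\pm\circ(\mathbf{B}\,\mathbf{C}^\pm))=\mathbf{C}^\pm\circ((\mathbf{B}\,\mathbf{C}^\pm)\circ\mathbf{C}^\pm)$; $(\mathbf{B}\,\mathbf{B})\circ\mathbf{C}^\pm=\mathbf{C}^\pm\circ((\mathbf{B}\,\mathbf{C}^\pm)\circ\mathbf{B})$; $(\mathbf{B}\,\boldsymbol{\theta}^\pm)\circ\mathbf{B}=(\mathbf{C}^\star\,\mathbf{B}\,\boldsymbol{\theta}^\pm)\circ\mathbf{B}$; $\boldsymbol{\theta}^\pm\circ\boldsymbol{\theta}^\mp=\mathbf{B}\,\mathbf{I}$; $\mathbf{C}^\star\,\boldsymbol{\theta}^\star\,a=\mathbf{C}^\star\,\mathbf{I}\,a$; $\mathbf{B}\circ\boldsymbol{\theta}^\pm=\boldsymbol{\theta}^\pm\circ(\mathbf{C}^\pm\circ(\boldsymbol{\theta}^\pm\circ(\mathbf{C}^\pm\circ\mathbf{B})))$; $(\mathbf{C}^\star\,\mathbf{B}\,\mathbf{Tr})\circ\mathbf{B}=(\mathbf{B}\,\mathbf{Tr})\circ\mathbf{B}^2$; $(\mathbf{B}\,\mathbf{Tr})\circ((\mathbf{C}^\star\,\mathbf{B}\,\mathbf{B})\circ\mathbf{B})=\mathbf{B}\circ\mathbf{Tr}$;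 $\mathbf{Tr}\,\mathbf{C}^\pm=\boldsymbol{\theta}^\pm$; $\mathbf{Tr}^2\circ((\mathbf{C}^\star\,\mathbf{B}\,\mathbf{C}^-)\circ(\mathbf{B}\,\mathbf{C}^+))=\mathbf{Tr}^2$. An isomorphism of ribbon combinatory algebras is a bijection preserving application and the seven constants. Internal PROB: write $a^\bullet:=\mathbf{C}^+\,\mathbf{I}\,a$; $a$ has arity $m\to n$ if $a^\bullet\circ\mathbf{B}^{m+1}=(\mathbf{B}\,a)\circ\mathbf{B}^n$. $\mathcal{I}_{\mathcal{A}}$ has objects the natural numbers, $\mathcal{I}_{\mathcal{A}}(m,n)$ the elements of arity $m\to n$, composite of $a:l\to m$, $b:m\to n$ equal to $a\circ b$ (diagrammatic order), identities $\mathbf{I}$, tensor $m+n$ on objects with unit $0$, and for $a:m\to n$, $b:m'\to n'$, $a+b:=a\circ(\mathbf{B}^n\,b)$ (so $l+a=\mathbf{B}^l\,a$, $a+l=a$). Braid: $\boldsymbol{\sigma}_{0,1}=\mathbf{I}$, $\boldsymbol{\sigma}_{m+1,1}=(\mathbf{B}\,\boldsymbol{\sigma}_{m,1})\circ\mathbf{C}^+$, $\boldsymbol{\sigma}_{m,0}=\mathbf{I}$, $\boldsymbol{\sigma}_{m,n+1}=\boldsymbol{\sigma}_{m,1}\circ(\mathbf{B}\,\boldsymbol{\sigma}_{m,n})$. Twist: $\boldsymbol{\theta}_0=\mathbf{I}$, $\boldsymbol{\theta}_1=\boldsymbol{\theta}^+$, $\boldsymbol{\theta}_{m+1}=\boldsymbol{\theta}^+\circ(\boldsymbol{\sigma}_{1,m}\circ(\boldsymbol{\theta}_m\circ\boldsymbol{\sigma}_{m,1}))$.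 Ribbon category: a (strict) braided monoidal category with braid $\sigma$, natural twist isomorphism $\theta$ with $\theta_{X\otimes Y}=\sigma_{X,Y};(\theta_Y\otimes\theta_X);\sigma_{Y,X}$, every object $X$ having a left dual $X^*$ with unit $\eta_X:I\to X\otimes X^*$ and counit $\varepsilon_X:X^*\otimes X\to I$ satisfying the snake equations, and $(\theta_X)^*=\theta_{X^*}$; composition $f;g$ is diagrammatic. Its trace is $\mathrm{Tr}^X_{U,V}(f)=(U\otimes\eta_X);(f\otimes X^* );(V\otimes(\sigma_{X,X^*};(X^*\otimes\theta_X);\varepsilon_X))$ for $f:U\otimes X\to V\otimes X$. A reflexive object is an object $A$ with an isomorphism $\varphi:A\otimes A^*\to A$. Set $\mathbf{app}:=(\varphi^{-1}\otimes A);(A\otimes\varepsilon_A):A\otimes A\to A$, $\mathbf{lam}:=(A\otimes\eta_A);(A\otimes A\otimes\theta_{A^*}^{-1});(A\otimes\sigma^{-1}_{A^*,A});(\varphi\otimes A):A\to A\otimes A$; $\mathbf{app}_0=\mathrm{id}_A$, $\mathbf{app}_{n+1}=(\mathbf{app}\otimes A^{\otimes n});\mathbf{app}_n$; $\mathbf{lam}_0=\mathrm{id}_A$, $\mathbf{lam}_{m+1}=\mathbf{lam}_m;(\mathbf{lam}\otimes A^{\otimes m})$; for $f:A^{\otimes m}\to A^{\otimes n}$, $F(f):=\mathrm{Tr}^A_{I,A}(\mathbf{lam}_m;(\mathbf{lam}\otimes f);(A\otimes\mathbf{app}_n)):I\to A$. The ribbon combinatory algebra arising from $(A,\varphi)$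 is the set of morphisms $I\to A$ with application $a\,b=(a\otimes b);\mathbf{app}$ and constants $\mathbf{B}=F(\mathbf{app})$, $\mathbf{C}^\pm=F(\sigma^{\pm1}_{A,A})$, $\mathbf{I}=F(\mathrm{id}_I)$, $\boldsymbol{\theta}^\pm=F(\theta_A^{\pm1})$, $\mathbf{Tr}=F(\mathbf{lam})$. *)

theory Defs
  imports Main
begin

section \<open>Ribbon combinatory algebras\<close>

text \<open>The superscripts $+$ and $-$ of the constants $\mathbf{C}$ and $\theta$ are turned into an
  argument. In the axioms, independent superscripts are independent variables of type \<open>sign\<close>,
  and a linked pair $\pm$, $\mp$ is \<open>s\<close>, \<open>flip s\<close>.\<close>

datatype sign = Plus | Minus

fun flip :: "sign \<Rightarrow> sign" where
  "flip Plus = Minus"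
| "flip Minus = Plus"

record 'a comb_alg =
  carrier :: "'a set"
  App :: "'a \<Rightarrow> 'a \<Rightarrow> 'a"  (infixl "\<cdot>\<index>" 90)
  cB :: 'a  ("\<B>\<index>")
  cC :: "sign \<Rightarrow> 'a"  ("\<C>\<index>")
  cI :: 'a  ("\<I>\<index>")
  cTheta :: "sign \<Rightarrow> 'a"  ("\<Theta>\<index>")
  cTr :: 'a  ("\<T>\<index>")

context
  fixes A :: "('a, 'x) comb_alg_scheme" (structure)
begin

definition ccomp :: "'a \<Rightarrow> 'a \<Rightarrow> 'a" where
  "ccomp a b = \<B> \<cdot> a \<cdot> b"

primrec cpow :: "'a \<Rightarrow> nat \<Rightarrow> 'a" where
  "cpow a 0 = \<I>"
| "cpow a (Suc n) = ccomp a (cpow a n)"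

end

notation ccomp ("(_ \<Zcomp>\<index> _)" [66, 65] 65)

locale ribbon_combinatory_algebra =
  fixes A :: "('a, 'x) comb_alg_scheme" (structure)
  assumes App_closed: "\<lbrakk>a \<in> carrier A; b \<in> carrier A\<rbrakk> \<Longrightarrow> a \<cdot> b \<in> carrier A"
    and B_closed: "\<B> \<in> carrier A"
    and C_closed: "\<C> s \<in> carrier A"
    and I_closed: "\<I> \<in> carrier A"
    and Theta_closed: "\<Theta> s \<in> carrier A"
    and Tr_closed: "\<T> \<in> carrier A"
    and B_app: "\<lbrakk>a \<in> carrier A; b \<in> carrier A; c \<in> carrier A\<rbrakk> \<Longrightarrow> \<B> \<cdot> a \<cdot> b \<cdot> c = a \<cdot> (b \<cdot> c)"
    and C_app: "\<lbrakk>a \<in> carrier A; b \<in> carrier A; c \<in> carrier A\<rbrakk> \<Longrightarrow> \<C> s \<cdot> a \<cdot> b \<cdot> c = a \<cdot> c \<cdot> b"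
    and I_app: "a \<in> carrier A \<Longrightarrow> \<I> \<cdot> a = a"
    and C_sign: "\<lbrakk>a \<in> carrier A; b \<in> carrier A\<rbrakk> \<Longrightarrow> \<C> Plus \<cdot> a \<cdot> b = \<C> Minus \<cdot> a \<cdot> b"
    and B_I: "\<B> \<cdot> \<I> = \<I>"
    and C_B_I: "\<C> s \<cdot> \<B> \<cdot> \<I> = \<B> \<cdot> \<I>"
    and B_assoc: "(\<C> s \<cdot> \<B> \<cdot> \<B>) \<Zcomp> (\<B> \<Zcomp> \<B>) = (\<B> \<cdot> \<B>) \<Zcomp> \<B>"
    and C_inverse: "\<C> s \<Zcomp> \<C> (flip s) = \<B> \<cdot> (\<B> \<cdot> \<I>)"
    and C_arity: "(\<C> s \<cdot> \<B> \<cdot> \<C> t) \<Zcomp> (\<B> \<Zcomp> \<B>) = (\<B> \<cdot> \<C> t) \<Zcomp> (\<B> \<Zcomp> \<B>)"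
    and C_braid: "(\<B> \<cdot> \<C> s) \<Zcomp> (\<C> s \<Zcomp> (\<B> \<cdot> \<C> s)) = \<C> s \<Zcomp> ((\<B> \<cdot> \<C> s) \<Zcomp> \<C> s)"
    and C_B_natural: "(\<B> \<cdot> \<B>) \<Zcomp> \<C> s = \<C> s \<Zcomp> ((\<B> \<cdot> \<C> s) \<Zcomp> \<B>)"
    and Theta_arity: "(\<B> \<cdot> \<Theta> t) \<Zcomp> \<B> = (\<C> s \<cdot> \<B> \<cdot> \<Theta> t) \<Zcomp> \<B>"
    and Theta_inverse: "\<Theta> s \<Zcomp> \<Theta> (flip s) = \<B> \<cdot> \<I>"
    and Theta_app: "a \<in> carrier A \<Longrightarrow> \<C> s \<cdot> \<Theta> t \<cdot> a = \<C> u \<cdot> \<I> \<cdot> a"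
    and Theta_B: "\<B> \<Zcomp> \<Theta> s = \<Theta> s \<Zcomp> (\<C> s \<Zcomp> (\<Theta> s \<Zcomp> (\<C> s \<Zcomp> \<B>)))"
    and Tr_arity: "(\<C> s \<cdot> \<B> \<cdot> \<T>) \<Zcomp> \<B> = (\<B> \<cdot> \<T>) \<Zcomp> cpow A \<B> 2"
    and Tr_natural: "(\<B> \<cdot> \<T>) \<Zcomp> ((\<C> s \<cdot> \<B> \<cdot> \<B>) \<Zcomp> \<B>) = \<B> \<Zcomp> \<T>"
    and Tr_yank: "\<T> \<cdot> \<C> s = \<Theta> s"
    and Tr_slide: "cpow A \<T> 2 \<Zcomp> ((\<C> s \<cdot> \<B> \<cdot> \<C> Minus) \<Zcomp> (\<B> \<cdot> \<C> Plus)) = cpow A \<T> 2"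

definition comb_alg_iso ::
    "('a \<Rightarrow> 'b) \<Rightarrow> ('a, 'x) comb_alg_scheme \<Rightarrow> ('b, 'y) comb_alg_scheme \<Rightarrow> bool" where
  "comb_alg_iso h A A' \<longleftrightarrow>
     bij_betw h (carrier A) (carrier A') \<and>
     (\<forall>a\<in>carrier A. \<forall>b\<in>carrier A. h (a \<cdot>\<^bsub>A\<^esub> b) = h a \<cdot>\<^bsub>A'\<^esub> h b) \<and>
     h \<B>\<^bsub>A\<^esub> = \<B>\<^bsub>A'\<^esub> \<and>
     (\<forall>s. h (\<C>\<^bsub>A\<^esub> s) = \<C>\<^bsub>A'\<^esub> s) \<and>
     h \<I>\<^bsub>A\<^esub> = \<I>\<^bsub>A'\<^esub> \<and>
     (\<forall>s. h (\<Theta>\<^bsub>A\<^esub> s) = \<Theta>\<^bsub>A'\<^esub> s) \<and>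
     h \<T>\<^bsub>A\<^esub> = \<T>\<^bsub>A'\<^esub>"

definition comb_alg_isomorphic ::
    "('a, 'x) comb_alg_scheme \<Rightarrow> ('b, 'y) comb_alg_scheme \<Rightarrow> bool" where
  "comb_alg_isomorphic A A' \<longleftrightarrow> (\<exists>h. comb_alg_iso h A A')"


section \<open>Ribbon categories\<close>

text \<open>Every arrow carries its domain and codomain. Composition is diagrammatic. The values of
  composition on non-composable pairs, and of all operations outside \<open>Obj\<close> and \<open>Arr\<close>, are
  irrelevant.\<close>

record ('o, 'm) cat_data =
  Obj :: "'o set"
  Arr :: "'m set"
  Dom :: "'m \<Rightarrow> 'o"
  Cod :: "'m \<Rightarrow> 'o"
  Ide :: "'o \<Rightarrow> 'm"  ("ide\<index>")
  Seq :: "'m \<Rightarrow> 'm \<Rightarrow> 'm"  (infixl "\<Zsemi>\<index>" 55)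
  Unit :: 'o  ("\<one>\<index>")
  TensO :: "'o \<Rightarrow> 'o \<Rightarrow> 'o"  (infixr "\<odot>\<index>" 70)
  TensM :: "'m \<Rightarrow> 'm \<Rightarrow> 'm"  (infixr "\<otimes>\<index>" 70)
  Braid :: "'o \<Rightarrow> 'o \<Rightarrow> 'm"  ("\<sigma>\<index>")
  Twist :: "'o \<Rightarrow> 'm"  ("\<theta>\<index>")

context
  fixes C :: "('o, 'm, 'x) cat_data_scheme" (structure)
begin

definition hom :: "'o \<Rightarrow> 'o \<Rightarrow> 'm set" where
  "hom X Y = {f \<in> Arr C. Dom C f = X \<and> Cod C f = Y}"

definition inverse_arrows :: "'m \<Rightarrow> 'm \<Rightarrow> bool" where
  "inverse_arrows f g \<longleftrightarrow>
     f \<in> Arr C \<and> g \<in> hom (Cod C f) (Dom C f) \<and>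
     f \<Zsemi> g = ide (Dom C f) \<and> g \<Zsemi> f = ide (Cod C f)"

definition iso_arrow :: "'m \<Rightarrow> bool" where
  "iso_arrow f \<longleftrightarrow> (\<exists>g. inverse_arrows f g)"

definition inv_arrow :: "'m \<Rightarrow> 'm" where
  "inv_arrow f = (THE g. inverse_arrows f g)"

definition left_dual :: "'o \<Rightarrow> 'o \<Rightarrow> 'm \<Rightarrow> 'm \<Rightarrow> bool" where
  "left_dual X D \<eta> \<epsilon> \<longleftrightarrow>
     D \<in> Obj C \<and> \<eta> \<in> hom \<one> (X \<odot> D) \<and> \<epsilon> \<in> hom (D \<odot> X) \<one> \<and>
     (\<eta> \<otimes> ide X) \<Zsemi> (ide X \<otimes> \<epsilon>) = ide X \<and>
     (ide D \<otimes> \<eta>) \<Zsemi> (\<epsilon> \<otimes> ide D) = ide D"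

text \<open>The dual $f^* : X^* \to X^*$ of an endomorphism $f : X \to X$, where $X^*$ is \<open>D\<close>.\<close>

definition dual_endo :: "'o \<Rightarrow> 'm \<Rightarrow> 'm \<Rightarrow> 'm \<Rightarrow> 'm" where
  "dual_endo D \<eta> \<epsilon> f = (ide D \<otimes> \<eta>) \<Zsemi> (ide D \<otimes> f \<otimes> ide D) \<Zsemi> (\<epsilon> \<otimes> ide D)"

end

locale category =
  fixes C :: "('o, 'm, 'x) cat_data_scheme" (structure)
  assumes Dom_Obj: "f \<in> Arr C \<Longrightarrow> Dom C f \<in> Obj C"
    and Cod_Obj: "f \<in> Arr C \<Longrightarrow> Cod C f \<in> Obj C"
    and ide_hom: "X \<in> Obj C \<Longrightarrow> ide X \<in> hom C X X"
    and Seq_hom: "\<lbrakk>f \<in> hom C X Y; g \<in> hom C Y Z\<rbrakk> \<Longrightarrow> f \<Zsemi> g \<in> hom C X Z"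
    and ide_Seq: "f \<in> hom C X Y \<Longrightarrow> ide X \<Zsemi> f = f"
    and Seq_ide: "f \<in> hom C X Y \<Longrightarrow> f \<Zsemi> ide Y = f"
    and Seq_assoc: "\<lbrakk>f \<in> hom C W X; g \<in> hom C X Y; h \<in> hom C Y Z\<rbrakk>
      \<Longrightarrow> (f \<Zsemi> g) \<Zsemi> h = f \<Zsemi> (g \<Zsemi> h)"

locale strict_monoidal_category = category +
  assumes Unit_Obj: "\<one> \<in> Obj C"
    and TensO_Obj: "\<lbrakk>X \<in> Obj C; Y \<in> Obj C\<rbrakk> \<Longrightarrow> X \<odot> Y \<in> Obj C"
    and TensM_hom: "\<lbrakk>f \<in> hom C X Y; g \<in> hom C X' Y'\<rbrakk> \<Longrightarrow> f \<otimes> g \<in> hom C (X \<odot> X') (Y \<odot> Y')"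
    and TensM_ide: "\<lbrakk>X \<in> Obj C; Y \<in> Obj C\<rbrakk> \<Longrightarrow> ide X \<otimes> ide Y = ide (X \<odot> Y)"
    and TensM_Seq: "\<lbrakk>f \<in> hom C X Y; g \<in> hom C Y Z; f' \<in> hom C X' Y'; g' \<in> hom C Y' Z'\<rbrakk>
      \<Longrightarrow> (f \<Zsemi> g) \<otimes> (f' \<Zsemi> g') = (f \<otimes> f') \<Zsemi> (g \<otimes> g')"
    and TensO_assoc: "\<lbrakk>X \<in> Obj C; Y \<in> Obj C; Z \<in> Obj C\<rbrakk> \<Longrightarrow> (X \<odot> Y) \<odot> Z = X \<odot> (Y \<odot> Z)"
    and Unit_TensO: "X \<in> Obj C \<Longrightarrow> \<one> \<odot> X = X"
    and TensO_Unit: "X \<in> Obj C \<Longrightarrow> X \<odot> \<one> = X"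
    and TensM_assoc: "\<lbrakk>f \<in> Arr C; g \<in> Arr C; h \<in> Arr C\<rbrakk> \<Longrightarrow> (f \<otimes> g) \<otimes> h = f \<otimes> (g \<otimes> h)"
    and Unit_TensM: "f \<in> Arr C \<Longrightarrow> ide \<one> \<otimes> f = f"
    and TensM_Unit: "f \<in> Arr C \<Longrightarrow> f \<otimes> ide \<one> = f"

locale braided_strict_monoidal_category = strict_monoidal_category +
  assumes Braid_hom: "\<lbrakk>X \<in> Obj C; Y \<in> Obj C\<rbrakk> \<Longrightarrow> \<sigma> X Y \<in> hom C (X \<odot> Y) (Y \<odot> X)"
    and Braid_iso: "\<lbrakk>X \<in> Obj C; Y \<in> Obj C\<rbrakk> \<Longrightarrow> iso_arrow C (\<sigma> X Y)"
    and Braid_natural: "\<lbrakk>f \<in> hom C X Y; g \<in> hom C X' Y'\<rbrakk>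
      \<Longrightarrow> (f \<otimes> g) \<Zsemi> \<sigma> Y Y' = \<sigma> X X' \<Zsemi> (g \<otimes> f)"
    and hexagon_left: "\<lbrakk>X \<in> Obj C; Y \<in> Obj C; Z \<in> Obj C\<rbrakk>
      \<Longrightarrow> \<sigma> (X \<odot> Y) Z = (ide X \<otimes> \<sigma> Y Z) \<Zsemi> (\<sigma> X Z \<otimes> ide Y)"
    and hexagon_right: "\<lbrakk>X \<in> Obj C; Y \<in> Obj C; Z \<in> Obj C\<rbrakk>
      \<Longrightarrow> \<sigma> X (Y \<odot> Z) = (\<sigma> X Y \<otimes> ide Z) \<Zsemi> (ide Y \<otimes> \<sigma> X Z)"

text \<open>Duals are a property here, not chosen structure: left duals are unique up to a canonical
  isomorphism, and by naturality of the twist the condition $(\theta_X)^* = \theta_{X^*}$ holds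
  for one left dual of $X$ iff it holds for all of them.\<close>

locale ribbon_category = braided_strict_monoidal_category +
  assumes Twist_hom: "X \<in> Obj C \<Longrightarrow> \<theta> X \<in> hom C X X"
    and Twist_iso: "X \<in> Obj C \<Longrightarrow> iso_arrow C (\<theta> X)"
    and Twist_natural: "f \<in> hom C X Y \<Longrightarrow> f \<Zsemi> \<theta> Y = \<theta> X \<Zsemi> f"
    and Twist_TensO: "\<lbrakk>X \<in> Obj C; Y \<in> Obj C\<rbrakk>
      \<Longrightarrow> \<theta> (X \<odot> Y) = \<sigma> X Y \<Zsemi> (\<theta> Y \<otimes> \<theta> X) \<Zsemi> \<sigma> Y X"
    and duals: "X \<in> Obj C
      \<Longrightarrow> \<exists>D \<eta> \<epsilon>. left_dual C X D \<eta> \<epsilon> \<and> dual_endo C D \<eta> \<epsilon> (\<theta> X) = \<theta> D"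


section \<open>The ribbon combinatory algebra of a reflexive object\<close>

context
  fixes C :: "('o, 'm, 'x) cat_data_scheme" (structure)
begin

text \<open>The trace $\mathrm{Tr}^X_{U,V}(f)$, where \<open>D\<close> is $X^*$.\<close>

definition ribbon_trace :: "'o \<Rightarrow> 'o \<Rightarrow> 'm \<Rightarrow> 'm \<Rightarrow> 'o \<Rightarrow> 'o \<Rightarrow> 'm \<Rightarrow> 'm" where
  "ribbon_trace X D \<eta> \<epsilon> U V f =
     (ide U \<otimes> \<eta>) \<Zsemi> (f \<otimes> ide D) \<Zsemi>
     (ide V \<otimes> (\<sigma> X D \<Zsemi> (ide D \<otimes> \<theta> X) \<Zsemi> \<epsilon>))"

primrec TensO_pow :: "'o \<Rightarrow> nat \<Rightarrow> 'o" where
  "TensO_pow X 0 = \<one>"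
| "TensO_pow X (Suc n) = X \<odot> TensO_pow X n"

end

text \<open>A reflexive object with the left dual \<open>D\<close> (unit \<open>\<eta>\<close>, counit \<open>\<epsilon>\<close>) that is used for it.\<close>

definition reflexive_object ::
    "('o, 'm, 'x) cat_data_scheme \<Rightarrow> 'o \<Rightarrow> 'o \<Rightarrow> 'm \<Rightarrow> 'm \<Rightarrow> 'm \<Rightarrow> bool" where
  "reflexive_object C X D \<eta> \<epsilon> \<phi> \<longleftrightarrow>
     X \<in> Obj C \<and> left_dual C X D \<eta> \<epsilon> \<and>
     \<phi> \<in> hom C (X \<odot>\<^bsub>C\<^esub> D) X \<and> iso_arrow C \<phi>"

context
  fixes C :: "('o, 'm, 'x) cat_data_scheme" (structure)
    and X D :: 'o and \<eta> \<epsilon> \<phi> :: 'm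
begin

definition app_arrow :: 'm where
  "app_arrow = (inv_arrow C \<phi> \<otimes> ide X) \<Zsemi> (ide X \<otimes> \<epsilon>)"

definition lam_arrow :: 'm where
  "lam_arrow =
     (ide X \<otimes> \<eta>) \<Zsemi> (ide X \<otimes> ide X \<otimes> inv_arrow C (\<theta> D)) \<Zsemi>
     (ide X \<otimes> inv_arrow C (\<sigma> D X)) \<Zsemi> (\<phi> \<otimes> ide X)"

primrec app_pow :: "nat \<Rightarrow> 'm" where
  "app_pow 0 = ide X"
| "app_pow (Suc n) = (app_arrow \<otimes> ide (TensO_pow C X n)) \<Zsemi> app_pow n"

primrec lam_pow :: "nat \<Rightarrow> 'm" where
  "lam_pow 0 = ide X"
| "lam_pow (Suc m) = lam_pow m \<Zsemi> (lam_arrow \<otimes> ide (TensO_pow C X m))"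

text \<open>The element $F(f)$ for $f : X^{\otimes m} \to X^{\otimes n}$.\<close>

definition encode :: "nat \<Rightarrow> nat \<Rightarrow> 'm \<Rightarrow> 'm" where
  "encode m n f =
     ribbon_trace C X D \<eta> \<epsilon> \<one> X
       (lam_pow m \<Zsemi> (lam_arrow \<otimes> f) \<Zsemi> (ide X \<otimes> app_pow n))"

definition reflexive_comb_alg :: "'m comb_alg" where
  "reflexive_comb_alg =
     \<lparr>carrier = hom C \<one> X,
      App = (\<lambda>a b. (a \<otimes> b) \<Zsemi> app_arrow),
      cB = encode 2 1 app_arrow,
      cC = (\<lambda>s. case s of Plus \<Rightarrow> encode 2 2 (\<sigma> X X)
                        | Minus \<Rightarrow> encode 2 2 (inv_arrow C (\<sigma> X X))),
      cI = encode 0 0 (ide \<one>),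
      cTheta = (\<lambda>s. case s of Plus \<Rightarrow> encode 1 1 (\<theta> X)
                            | Minus \<Rightarrow> encode 1 1 (inv_arrow C (\<theta> X))),
      cTr = encode 1 2 lam_arrow\<rparr>"

end


section \<open>The internal PROB\<close>

context
  fixes A :: "('a, 'x) comb_alg_scheme" (structure)
begin

definition arity :: "'a \<Rightarrow> nat \<Rightarrow> nat \<Rightarrow> bool" where
  "arity a m n \<longleftrightarrow> (\<C> Plus \<cdot> \<I> \<cdot> a) \<Zcomp> cpow A \<B> (m + 1) = (\<B> \<cdot> a) \<Zcomp> cpow A \<B> n"

primrec prob_braid_1 :: "nat \<Rightarrow> 'a" where
  "prob_braid_1 0 = \<I>"
| "prob_braid_1 (Suc m) = (\<B> \<cdot> prob_braid_1 m) \<Zcomp> \<C> Plus"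

primrec prob_braid :: "nat \<Rightarrow> nat \<Rightarrow> 'a" where
  "prob_braid m 0 = \<I>"
| "prob_braid m (Suc n) = prob_braid_1 m \<Zcomp> (\<B> \<cdot> prob_braid m n)"

fun prob_twist :: "nat \<Rightarrow> 'a" where
  "prob_twist 0 = \<I>"
| "prob_twist (Suc 0) = \<Theta> Plus"
| "prob_twist (Suc (Suc m)) =
     \<Theta> Plus \<Zcomp> (prob_braid 1 (Suc m) \<Zcomp> (prob_twist (Suc m) \<Zcomp> prob_braid (Suc m) 1))"

text \<open>An element may have several arities, so an arrow $m \to n$ is a triple \<open>(m, a, n)\<close>.\<close>

definition internal_prob :: "(nat, nat \<times> 'a \<times> nat) cat_data" where
  "internal_prob =
     \<lparr>Obj = UNIV,
      Arr = {(m, a, n). a \<in> carrier A \<and> arity a m n},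
      Dom = (\<lambda>(m, a, n). m),
      Cod = (\<lambda>(m, a, n). n),
      Ide = (\<lambda>n. (n, \<I>, n)),
      Seq = (\<lambda>(l, a, m) (m', b, n). (l, a \<Zcomp> b, n)),
      Unit = 0,
      TensO = (+),
      TensM = (\<lambda>(m, a, n) (m', b, n'). (m + m', a \<Zcomp> (cpow A \<B> n \<cdot> b), n + n')),
      Braid = (\<lambda>m n. (m + n, prob_braid m n, n + m)),
      Twist = (\<lambda>m. (m, prob_twist m, m))\<rparr>"

end

end

theory Submission
  imports Defs
begin

text \<open>
  Write $f ; g$ for \<open>f \<Zcomp> g\<close>. The elements with this product form a monoid on which
  \<open>\<B> \<cdot> _\<close> is an endomorphism. An element $a$ of arity $m \to n$ can be read off
  $(1 + a) ; \mathbf{B}^n$, and its arity says that this equals $a^\bullet ; \mathbf{B}^{m+1}$.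
  Naturality of the braid and of the twist for all arrows therefore follows from the cases of
  \<open>\<B>\<close> and of the closed elements $a^\bullet$.

  The arrows $\mathbf{Tr} : 1 \to 2$ and $\mathbf{B} : 2 \to 1$ behave like abstraction and
  application: $\mathbf{Tr} ; (1 + x) ; \mathbf{B} = 1 + \mathbf{Tr}\,x$ gives the beta law, and
  the eta law follows from it because closed elements are extensional. The object $1$ is its own
  dual. Regarding a function as an output together with a reversed input, the counit sends $u, v$ to
  the closed loop of $u \circ v$, and the unit is the pair of functions $\lambda x.\, y$ and
  $\lambda y.\, x$ with $x$ and $y$ tied together. Every object $n \geq 1$ is isomorphic to $1$, so
  all objects have duals. The trace of the ribbon category becomes \<open>\<T> \<cdot> _\<close>,
  and $F(a) = a^\bullet$ follows by applying both sides to arguments.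
\<close>

text \<open>Idle wires on the right leave an element unchanged, and idle wires on the left are
  powers of \<open>\<B> \<cdot> _\<close>. Equations of arrows are therefore equations in the
  monoid, and arities enter only through the interchange law and the naturality of braid and twist.
  No constant of the algebra is a unit or a counit, and the category has to return the constants on
  the nose, not up to isomorphism. This leaves little choice: once the counit \<open>eps\<close> and
  the unit \<open>eta\<close> satisfy the snake equations, application equals \<open>\<B>\<close>
  only if the inverse of the reflexive isomorphism is \<open>\<B>\<close> with its second input bent
  round by \<open>eta\<close>. That abstraction then equals \<open>\<T>\<close> is a condition on
  framings. Bending a wire through \<open>\<T>\<close> and \<open>\<B>\<close> leaves curls, and the
  signs in \<open>eps\<close>, \<open>eta\<close> and \<open>ev\<close> are fixed so that all curls
  cancel. The ribbon condition needs no formula for \<open>eta\<close>: a twist moves from one leg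
  to the other of every arrow from 0 to 2.\<close>

context ribbon_combinatory_algebra
begin

subsection \<open>Abstraction in the monoid of combinators\<close>

lemmas comb_closed [simp, intro] =
  App_closed B_closed C_closed I_closed Theta_closed Tr_closed

lemma ccomp_closed [simp, intro]:
  "\<lbrakk>a \<in> carrier A; b \<in> carrier A\<rbrakk> \<Longrightarrow> a \<Zcomp> b \<in> carrier A"
  by (simp add: ccomp_def)

lemma cpow_closed [simp, intro]: "a \<in> carrier A \<Longrightarrow> cpow A a n \<in> carrier A"
  by (induction n) auto

lemma App_B [simp]: "\<B> \<cdot> a \<cdot> b = a \<Zcomp> b"
  by (simp add: ccomp_def)

lemma ccomp_App [simp]:
  "\<lbrakk>a \<in> carrier A; b \<in> carrier A; c \<in> carrier A\<rbrakk> \<Longrightarrow> (a \<Zcomp> b) \<cdot> c = a \<cdot> (b \<cdot> c)"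
  unfolding ccomp_def by (rule B_app)

text \<open>The point-free axioms are used by applying both sides to arguments, here
  \<open>B_assoc\<close> to \<open>a\<close> and \<open>b\<close>. Associativity follows by applying
  this equation to a third argument.\<close>

lemma B_ccomp [simp]:
  assumes "a \<in> carrier A" "b \<in> carrier A"
  shows "\<B> \<cdot> (a \<Zcomp> b) = (\<B> \<cdot> a) \<Zcomp> (\<B> \<cdot> b)"
proof -
  have "((\<C> Plus \<cdot> \<B> \<cdot> \<B>) \<Zcomp> (\<B> \<Zcomp> \<B>)) \<cdot> a \<cdot> b = ((\<B> \<cdot> \<B>) \<Zcomp> \<B>) \<cdot> a \<cdot> b"
    by (simp only: B_assoc)
  then show ?thesis using assms by (simp add: C_app)
qed

lemma ccomp_assoc [simp]:
  assumes "a \<in> carrier A" "b \<in> carrier A" "c \<in> carrier A"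
  shows "(a \<Zcomp> b) \<Zcomp> c = a \<Zcomp> (b \<Zcomp> c)"
proof -
  have "(a \<Zcomp> b) \<Zcomp> c = \<B> \<cdot> (a \<Zcomp> b) \<cdot> c" by (simp only: App_B)
  also have "\<dots> = ((\<B> \<cdot> a) \<Zcomp> (\<B> \<cdot> b)) \<cdot> c" using assms by (simp only: B_ccomp)
  also have "\<dots> = a \<Zcomp> (b \<Zcomp> c)" using assms by simp
  finally show ?thesis .
qed

lemmas [simp] = B_I I_app

lemma I_ccomp [simp]: "a \<in> carrier A \<Longrightarrow> \<I> \<Zcomp> a = a"
  by (simp add: ccomp_def)

lemma ccomp_I [simp]:
  assumes "a \<in> carrier A"
  shows "a \<Zcomp> \<I> = a"
proof -
  have "\<C> Plus \<cdot> \<B> \<cdot> \<I> \<cdot> a = \<B> \<cdot> \<I> \<cdot> a" by (simp only: C_B_I)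
  then show ?thesis using assms by (simp add: C_app)
qed

text \<open>The simplifier keeps composites nested to the right, where the left side of an equation
  on a short composite no longer occurs as a subterm. These rules restate such an equation with a
  tail \<open>r\<close>.\<close>

lemma ccomp_tail2:
  "\<lbrakk>x \<Zcomp> y = z; x \<in> carrier A; y \<in> carrier A; r \<in> carrier A\<rbrakk> \<Longrightarrow> x \<Zcomp> (y \<Zcomp> r) = z \<Zcomp> r"
  by (metis ccomp_assoc)

lemma ccomp_tail3:
  "\<lbrakk>x \<Zcomp> (y \<Zcomp> w) = z; x \<in> carrier A; y \<in> carrier A; w \<in> carrier A; r \<in> carrier A\<rbrakk>
    \<Longrightarrow> x \<Zcomp> (y \<Zcomp> (w \<Zcomp> r)) = z \<Zcomp> r"
  by (metis ccomp_assoc ccomp_closed)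

lemma flip_flip [simp]: "flip (flip s) = s"
  by (cases s) auto

lemma C_flip [simp]: "\<C> s \<Zcomp> \<C> (flip s) = \<I>"
  by (simp add: C_inverse)

lemma flip_C [simp]: "\<C> (flip s) \<Zcomp> \<C> s = \<I>"
  using C_flip [of "flip s"] by simp

lemma Theta_flip [simp]: "\<Theta> s \<Zcomp> \<Theta> (flip s) = \<I>"
  by (simp add: Theta_inverse)

lemma flip_Theta [simp]: "\<Theta> (flip s) \<Zcomp> \<Theta> s = \<I>"
  using Theta_flip [of "flip s"] by simp

lemma C_Plus_Minus [simp]: "\<C> Plus \<Zcomp> \<C> Minus = \<I>" "\<C> Minus \<Zcomp> \<C> Plus = \<I>"
  using C_flip [of Plus] C_flip [of Minus] by auto

lemma Theta_Plus_Minus [simp]: "\<Theta> Plus \<Zcomp> \<Theta> Minus = \<I>" "\<Theta> Minus \<Zcomp> \<Theta> Plus = \<I>"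
  using Theta_flip [of Plus] Theta_flip [of Minus] by auto

lemma B_cancel:
  assumes "x \<Zcomp> y = \<I>" "x \<in> carrier A" "y \<in> carrier A"
  shows "(\<B> \<cdot> x) \<Zcomp> (\<B> \<cdot> y) = \<I>"
  using assms by (metis B_ccomp B_I)

lemma B_eq:
  assumes "x = y" shows "\<B> \<cdot> x = \<B> \<cdot> y"
  using assms by simp

lemma B_inject:
  "\<lbrakk>\<B> \<cdot> x = \<B> \<cdot> y; x \<in> carrier A; y \<in> carrier A\<rbrakk> \<Longrightarrow> x = y"
  by (metis App_B ccomp_I)

lemma C_flip_App [simp]: "a \<in> carrier A \<Longrightarrow> \<C> s \<cdot> (\<C> (flip s) \<cdot> a) = a"
  by (metis C_closed C_flip I_app ccomp_App)

lemma flip_C_App [simp]: "a \<in> carrier A \<Longrightarrow> \<C> (flip s) \<cdot> (\<C> s \<cdot> a) = a"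
  by (metis C_closed flip_C I_app ccomp_App)

lemma C_inject: "\<lbrakk>\<C> s \<cdot> a = \<C> s \<cdot> b; a \<in> carrier A; b \<in> carrier A\<rbrakk> \<Longrightarrow> a = b"
  by (metis flip_C_App)

lemma C_indep: "\<lbrakk>a \<in> carrier A; b \<in> carrier A\<rbrakk> \<Longrightarrow> \<C> s \<cdot> a \<cdot> b = \<C> t \<cdot> a \<cdot> b"
  by (cases s; cases t; simp add: C_sign)

lemma C_commute:
  assumes "x \<in> carrier A"
  shows "\<C> s \<Zcomp> (\<B> \<cdot> (\<B> \<cdot> x)) = (\<B> \<cdot> (\<B> \<cdot> x)) \<Zcomp> \<C> s"
proof -
  have "((\<C> Plus \<cdot> \<B> \<cdot> \<C> s) \<Zcomp> (\<B> \<Zcomp> \<B>)) \<cdot> x = ((\<B> \<cdot> \<C> s) \<Zcomp> (\<B> \<Zcomp> \<B>)) \<cdot> x"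
    by (simp only: C_arity)
  then show ?thesis using assms by (simp add: C_app)
qed

lemma C_App_shift:
  assumes "x \<in> carrier A" "y \<in> carrier A"
  shows "\<C> s \<cdot> ((\<B> \<cdot> x) \<Zcomp> y) = (\<B> \<cdot> x) \<Zcomp> (\<C> s \<cdot> y)"
proof -
  have "(\<C> s \<Zcomp> (\<B> \<cdot> (\<B> \<cdot> x))) \<cdot> y = ((\<B> \<cdot> (\<B> \<cdot> x)) \<Zcomp> \<C> s) \<cdot> y"
    by (simp only: C_commute assms)
  then show ?thesis using assms by simp
qed

lemma B_ccomp_C_App:
  assumes "x \<in> carrier A"
  shows "\<B> \<Zcomp> (\<C> s \<cdot> x) = \<C> s \<cdot> (\<C> s \<Zcomp> (\<B> \<cdot> x))"
proof -
  have "((\<B> \<cdot> \<B>) \<Zcomp> \<C> s) \<cdot> x = (\<C> s \<Zcomp> ((\<B> \<cdot> \<C> s) \<Zcomp> \<B>)) \<cdot> x"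
    by (simp only: C_B_natural)
  then show ?thesis using assms by simp
qed

text \<open>The mirror image of \<open>C_B_natural\<close>: that axiom is taken at the opposite sign
  and its crossings are cancelled.\<close>

lemma B_ccomp_C: "\<B> \<Zcomp> \<C> s = (\<B> \<cdot> \<C> s) \<Zcomp> (\<C> s \<Zcomp> (\<B> \<cdot> \<B>))"
proof -
  have "(\<B> \<cdot> \<C> s) \<Zcomp> (\<C> s \<Zcomp> (\<B> \<cdot> \<B>))
      = (\<B> \<cdot> \<C> s) \<Zcomp> (\<C> s \<Zcomp> (((\<B> \<cdot> \<B>) \<Zcomp> \<C> (flip s)) \<Zcomp> \<C> s))"
    by simp
  also have "\<dots> = (\<B> \<cdot> \<C> s) \<Zcomp> (\<C> s \<Zcomp> ((\<C> (flip s) \<Zcomp> ((\<B> \<cdot> \<C> (flip s)) \<Zcomp> \<B>)) \<Zcomp> \<C> s))"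
    by (simp only: C_B_natural)
  also have "\<dots> = \<B> \<Zcomp> \<C> s"
    by (simp add: C_flip [THEN ccomp_tail2] B_cancel [THEN ccomp_tail2])
  finally show ?thesis by simp
qed

lemma C_App_ccomp:
  assumes "a \<in> carrier A" "b \<in> carrier A"
  shows "(\<C> s \<cdot> a) \<Zcomp> b = \<C> s \<cdot> (\<C> s \<cdot> (\<B> \<Zcomp> a) \<cdot> b)"
proof -
  have "(\<B> \<Zcomp> \<C> s) \<cdot> a \<cdot> b = ((\<B> \<cdot> \<C> s) \<Zcomp> (\<C> s \<Zcomp> (\<B> \<cdot> \<B>))) \<cdot> a \<cdot> b"
    by (simp only: B_ccomp_C)
  then show ?thesis using assms by simp
qed

section \<open>Elements of the algebra as closed arrows from 0 to 1\<close>

definition dot :: "'a \<Rightarrow> 'a" where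
  "dot a = \<C> Plus \<cdot> \<I> \<cdot> a"

lemma dot_closed [simp, intro]: "a \<in> carrier A \<Longrightarrow> dot a \<in> carrier A"
  by (simp add: dot_def)

text \<open>With both arguments present the sign of \<open>\<C> s\<close> is immaterial by
  \<open>C_sign\<close>. The rule turns the patterns \<open>\<C> s \<cdot> \<B> \<cdot> x\<close> of
  the axioms into composites with \<open>dot x\<close>, and thus several axioms into arity
  statements.\<close>

lemma C_App_App_eq_dot:
  assumes "x \<in> carrier A" "a \<in> carrier A"
  shows "\<C> s \<cdot> x \<cdot> a = dot a \<Zcomp> x"
proof -
  have "dot a \<Zcomp> x = (\<B> \<Zcomp> (\<C> Plus \<cdot> \<I>)) \<cdot> a \<cdot> x"
    using assms by (simp add: dot_def)
  also have "\<dots> = \<C> Plus \<cdot> x \<cdot> a"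
    using assms by (simp add: B_ccomp_C_App C_app)
  finally show ?thesis using C_indep assms by metis
qed

lemma dot_App: "\<lbrakk>a \<in> carrier A; b \<in> carrier A\<rbrakk> \<Longrightarrow> dot a \<cdot> b = b \<cdot> a"
  by (simp add: dot_def C_app)

text \<open>Signs may be changed freely under two arguments. They are chosen so that
  \<open>C_App_ccomp\<close> applies inside and the two outer flips are inverse to each
  other.\<close>

lemma C_B_ccomp_App:
  assumes "x \<in> carrier A" "a \<in> carrier A" "b \<in> carrier A"
  shows "\<C> s \<cdot> (\<C> t \<cdot> (\<B> \<Zcomp> x) \<cdot> a) \<cdot> b = \<C> u \<cdot> x \<cdot> (a \<cdot> b)"
proof -
  have "\<C> t \<cdot> (\<B> \<Zcomp> x) \<cdot> a = \<C> Plus \<cdot> (\<C> Minus \<cdot> (\<C> Minus \<cdot> (\<B> \<Zcomp> x) \<cdot> a))"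
    using assms C_flip_App [of _ Plus] C_indep by simp
  also have "\<dots> = \<C> Plus \<cdot> ((\<C> Minus \<cdot> x) \<Zcomp> a)"
    using assms by (simp add: C_App_ccomp)
  finally have "\<C> s \<cdot> (\<C> t \<cdot> (\<B> \<Zcomp> x) \<cdot> a) \<cdot> b = \<C> Minus \<cdot> (\<C> Plus \<cdot> ((\<C> Minus \<cdot> x) \<Zcomp> a)) \<cdot> b"
    using C_indep assms by simp
  also have "\<dots> = \<C> Minus \<cdot> x \<cdot> (a \<cdot> b)"
    using assms flip_C_App [of _ Plus] by simp
  finally show ?thesis using C_indep assms by (metis App_closed)
qed

lemma dot_of_App:
  assumes "a \<in> carrier A" "b \<in> carrier A"
  shows "dot (a \<cdot> b) = dot b \<Zcomp> (dot a \<Zcomp> \<B>)"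
proof -
  have "dot (a \<cdot> b) = \<C> Plus \<cdot> (\<C> Plus \<cdot> (\<B> \<Zcomp> \<I>) \<cdot> a) \<cdot> b"
    unfolding dot_def using assms by (intro C_B_ccomp_App [symmetric]) auto
  then show ?thesis using assms by (simp add: C_App_App_eq_dot)
qed

lemma dot_I_B: "dot \<I> \<Zcomp> \<B> = \<I>"
  using C_B_I [of Plus] by (simp add: C_App_App_eq_dot)

lemma dot_ccomp_B: "a \<in> carrier A \<Longrightarrow> b \<in> carrier A \<Longrightarrow>
    dot (a \<Zcomp> b) = dot b \<Zcomp> (dot a \<Zcomp> (dot \<B> \<Zcomp> (\<B> \<Zcomp> \<B>)))"
  unfolding ccomp_def [of A a b] by (simp add: dot_of_App del: App_B)

lemma C_B2_CI: "\<C> s \<cdot> (\<B> \<Zcomp> \<B>) \<cdot> (\<C> t \<cdot> \<I>) = \<C> t \<Zcomp> \<B>"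
proof -
  have *: "\<C> t \<cdot> (\<B> \<Zcomp> \<B>) \<cdot> \<I> = \<B>"
    by (simp add: C_App_App_eq_dot dot_I_B [THEN ccomp_tail2])
  have "\<C> s \<cdot> (\<B> \<Zcomp> \<B>) \<cdot> (\<C> t \<cdot> \<I>) = \<C> t \<cdot> (\<C> t \<cdot> (\<B> \<Zcomp> (\<B> \<Zcomp> \<B>)) \<cdot> \<C> t) \<cdot> \<I>"
    by (intro C_B_ccomp_App [symmetric]) auto
  also have "\<C> t \<cdot> (\<B> \<Zcomp> (\<B> \<Zcomp> \<B>)) \<cdot> \<C> t = (\<C> t \<cdot> \<B> \<cdot> \<C> t) \<Zcomp> (\<B> \<Zcomp> \<B>)"
    by (simp add: C_App_App_eq_dot)
  also have "\<dots> = (\<B> \<cdot> \<C> t) \<Zcomp> (\<B> \<Zcomp> \<B>)"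
    by (simp only: C_arity)
  also have "\<C> t \<cdot> \<dots> \<cdot> \<I> = \<C> t \<Zcomp> (\<C> t \<cdot> (\<B> \<Zcomp> \<B>) \<cdot> \<I>)"
    by (simp add: C_App_shift)
  finally show ?thesis unfolding * .
qed

text \<open>This is the arity equation that makes \<open>dot a\<close> an arrow from 0 to 1.\<close>

lemma dot_dot_B:
  assumes "a \<in> carrier A"
  shows "dot (dot a) \<Zcomp> \<B> = (\<B> \<cdot> dot a) \<Zcomp> \<B>"
proof -
  have "dot (dot a) \<Zcomp> \<B> = \<C> Plus \<cdot> \<B> \<cdot> (\<C> Plus \<cdot> \<I> \<cdot> a)"
    using assms by (simp add: C_App_App_eq_dot)
  also have "\<dots> = \<C> Plus \<cdot> (\<C> Plus \<cdot> (\<B> \<Zcomp> \<B>) \<cdot> (\<C> Plus \<cdot> \<I>)) \<cdot> a"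
    using assms by (intro C_B_ccomp_App [symmetric]) auto
  also have "\<dots> = (\<C> Plus \<cdot> (\<C> Plus \<Zcomp> \<B>)) \<cdot> a"
    by (simp only: C_B2_CI)
  \<comment> \<open>Pulling \<open>\<B>\<close> out as an argument allows it to be exchanged with
    \<open>a\<close>. What remains is the pattern of \<open>B_ccomp_C_App\<close> with
    \<open>\<C> Plus\<close> in place of \<open>x\<close>.\<close>
  also have "\<dots> = (\<C> Plus \<Zcomp> ((\<B> \<cdot> \<C> Plus))) \<cdot> \<B> \<cdot> a"
    using assms by simp
  also have "\<dots> = (\<C> Plus \<cdot> (\<C> Plus \<Zcomp> (\<B> \<cdot> \<C> Plus))) \<cdot> a \<cdot> \<B>"
    using assms by (simp add: C_app)
  also have "\<dots> = (\<B> \<Zcomp> (\<C> Plus \<cdot> \<C> Plus)) \<cdot> a \<cdot> \<B>"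
    using assms by (simp only: B_ccomp_C_App comb_closed)
  also have "\<C> Plus \<cdot> \<C> Plus = \<B> \<Zcomp> (\<C> Plus \<cdot> \<I>)"
    by (simp add: B_ccomp_C_App)
  finally show ?thesis using assms by (simp add: dot_def)
qed

subsection \<open>Braids of the internal PROB\<close>

lemma dot_natural: "\<lbrakk>a \<in> carrier A; x \<in> carrier A\<rbrakk> \<Longrightarrow> dot a \<Zcomp> (\<B> \<cdot> x) = x \<Zcomp> dot a"
  using arg_cong [OF dot_dot_B [of a], of "\<lambda>y. y \<cdot> x"] by (simp add: dot_App)

lemma cpow_add: "a \<in> carrier A \<Longrightarrow> cpow A a (m + n) = cpow A a m \<Zcomp> cpow A a n"
  by (induction m) auto

lemma cpow_Suc_right: "a \<in> carrier A \<Longrightarrow> cpow A a (Suc n) = cpow A a n \<Zcomp> a"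
  using cpow_add [of a n 1] by simp

lemma cpow_B_I [simp]: "cpow A \<B> n \<cdot> \<I> = \<I>"
  by (induction n) auto

lemma cpow_B_ccomp [simp]:
  "\<lbrakk>a \<in> carrier A; b \<in> carrier A\<rbrakk> \<Longrightarrow>
    cpow A \<B> n \<cdot> (a \<Zcomp> b) = (cpow A \<B> n \<cdot> a) \<Zcomp> (cpow A \<B> n \<cdot> b)"
  by (induction n) auto

lemma cpow_B_add_App:
  "a \<in> carrier A \<Longrightarrow> cpow A \<B> (m + n) \<cdot> a = cpow A \<B> m \<cdot> (cpow A \<B> n \<cdot> a)"
  by (simp add: cpow_add)

section \<open>Arities and the interchange law\<close>

lemma arity_iff:
  "a \<in> carrier A \<Longrightarrow>
    arity A a m n \<longleftrightarrow> dot a \<Zcomp> cpow A \<B> (Suc m) = (\<B> \<cdot> a) \<Zcomp> cpow A \<B> n"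
  unfolding arity_def dot_def by simp

text \<open>The arity equation of \<open>a\<close> applied to \<open>b\<close>, with
  \<open>dot_App\<close> reversing the left side. The commutation rules for
  \<open>\<B> \<cdot> x\<close> with \<open>\<B>\<close>, \<open>\<T>\<close>,
  \<open>\<Theta> s\<close>, \<open>eps\<close> and \<open>eta\<close> are instances.\<close>

lemma interchange:
  assumes "arity A a m n" "a \<in> carrier A" "b \<in> carrier A"
  shows "a \<Zcomp> (cpow A \<B> n \<cdot> b) = (cpow A \<B> m \<cdot> b) \<Zcomp> a"
proof -
  have "(dot a \<Zcomp> cpow A \<B> (Suc m)) \<cdot> b = ((\<B> \<cdot> a) \<Zcomp> cpow A \<B> n) \<cdot> b"
    using assms arity_iff by simp
  then show ?thesis using assms by (simp add: dot_App)
qed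

lemma arity_I [simp]: "arity A \<I> n n"
  by (simp add: arity_iff dot_I_B [THEN ccomp_tail2])

lemma arity_right:
  assumes "arity A a m n" "a \<in> carrier A"
  shows "arity A a (m + k) (n + k)"
  using assms ccomp_tail2 [of "dot a" "cpow A \<B> (Suc m)" _ "cpow A \<B> k"]
  by (simp add: arity_iff cpow_add del: cpow.simps) (simp add: cpow_add)

lemma arity_dot [simp]: "a \<in> carrier A \<Longrightarrow> arity A (dot a) 0 (Suc 0)"
  using dot_dot_B by (simp add: arity_iff)

lemma arity_B [simp]: "arity A \<B> 2 (Suc 0)"
  using B_assoc [of Plus] by (simp add: arity_iff C_App_App_eq_dot numeral_2_eq_2)

lemma arity_C [simp]: "arity A (\<C> s) 2 2"
  using C_arity [of Plus s] by (simp add: arity_iff C_App_App_eq_dot numeral_2_eq_2)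

lemma arity_Theta [simp]: "arity A (\<Theta> s) (Suc 0) (Suc 0)"
  using Theta_arity [of s Plus] by (simp add: arity_iff C_App_App_eq_dot numeral_2_eq_2)

lemma arity_Tr [simp]: "arity A \<T> (Suc 0) 2"
  using Tr_arity [of Plus] by (simp add: arity_iff C_App_App_eq_dot numeral_2_eq_2)

lemma B_natural: "x \<in> carrier A \<Longrightarrow> \<B> \<Zcomp> (\<B> \<cdot> x) = (\<B> \<cdot> (\<B> \<cdot> x)) \<Zcomp> \<B>"
  using interchange [OF arity_B, of x] by (simp add: numeral_2_eq_2)

lemma Tr_natural': "x \<in> carrier A \<Longrightarrow> \<T> \<Zcomp> (\<B> \<cdot> (\<B> \<cdot> x)) = (\<B> \<cdot> x) \<Zcomp> \<T>"
  using interchange [OF arity_Tr, of x] by (simp add: numeral_2_eq_2)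

lemma Theta_natural: "x \<in> carrier A \<Longrightarrow> \<Theta> s \<Zcomp> (\<B> \<cdot> x) = (\<B> \<cdot> x) \<Zcomp> \<Theta> s"
  using interchange [OF arity_Theta [of s], of x] by simp

lemma dot_B_B: "dot \<B> \<Zcomp> (\<B> \<Zcomp> (\<B> \<Zcomp> \<B>)) = (\<B> \<cdot> \<B>) \<Zcomp> \<B>"
  using arity_B by (simp add: arity_iff numeral_2_eq_2 del: arity_B)

text \<open>\<open>dot_ccomp_B\<close> expands the closed form of the composite. The arity of
  \<open>\<B>\<close> leaves a factor \<open>\<B> \<cdot> \<B>\<close> that slides left across
  \<open>dot a\<close>, after which the arities of \<open>a\<close> and \<open>b\<close> apply in
  turn.\<close>

lemma arity_ccomp:
  assumes "arity A a l m" "arity A b m n" "a \<in> carrier A" "b \<in> carrier A"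
  shows "arity A (a \<Zcomp> b) l n"
proof -
  note [simp] = assms(3,4)
  have a: "dot a \<Zcomp> (\<B> \<Zcomp> cpow A \<B> l) = (\<B> \<cdot> a) \<Zcomp> cpow A \<B> m"
    using assms by (simp add: arity_iff)
  have b: "dot b \<Zcomp> (\<B> \<Zcomp> cpow A \<B> m) = (\<B> \<cdot> b) \<Zcomp> cpow A \<B> n"
    using assms by (simp add: arity_iff)
  have "dot (a \<Zcomp> b) \<Zcomp> cpow A \<B> (Suc l)
      = dot b \<Zcomp> (dot a \<Zcomp> ((dot \<B> \<Zcomp> (\<B> \<Zcomp> (\<B> \<Zcomp> \<B>))) \<Zcomp> cpow A \<B> l))"
    by (simp add: dot_ccomp_B)
  also have "\<dots> = dot b \<Zcomp> ((dot a \<Zcomp> (\<B> \<cdot> \<B>)) \<Zcomp> (\<B> \<Zcomp> cpow A \<B> l))"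
    unfolding dot_B_B by simp
  also have "\<dots> = dot b \<Zcomp> (\<B> \<Zcomp> (dot a \<Zcomp> (\<B> \<Zcomp> cpow A \<B> l)))"
    by (simp only: dot_natural assms comb_closed) simp
  also have "\<dots> = dot b \<Zcomp> ((\<B> \<Zcomp> (\<B> \<cdot> a)) \<Zcomp> cpow A \<B> m)"
    unfolding a by simp
  also have "\<dots> = (dot b \<Zcomp> (\<B> \<cdot> (\<B> \<cdot> a))) \<Zcomp> (\<B> \<Zcomp> cpow A \<B> m)"
    by (simp only: B_natural assms) simp
  also have "\<dots> = (\<B> \<cdot> a) \<Zcomp> (dot b \<Zcomp> (\<B> \<Zcomp> cpow A \<B> m))"
    by (simp only: dot_natural assms comb_closed) simp
  also have "\<dots> = (\<B> \<cdot> (a \<Zcomp> b)) \<Zcomp> cpow A \<B> n"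
    unfolding b by simp
  finally show ?thesis by (simp add: arity_iff del: cpow.simps)
qed

lemma arity_shift:
  assumes "arity A a m n" "a \<in> carrier A"
  shows "arity A (\<B> \<cdot> a) (Suc m) (Suc n)"
proof -
  note [simp] = assms(2)
  have a: "dot a \<Zcomp> (\<B> \<Zcomp> cpow A \<B> m) = (\<B> \<cdot> a) \<Zcomp> cpow A \<B> n"
    using assms by (simp add: arity_iff)
  have "dot (\<B> \<cdot> a) \<Zcomp> cpow A \<B> (Suc (Suc m))
      = dot a \<Zcomp> ((dot \<B> \<Zcomp> (\<B> \<Zcomp> (\<B> \<Zcomp> \<B>))) \<Zcomp> cpow A \<B> m)"
    by (simp add: dot_of_App)
  also have "\<dots> = (dot a \<Zcomp> (\<B> \<cdot> \<B>)) \<Zcomp> (\<B> \<Zcomp> cpow A \<B> m)"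
    unfolding dot_B_B by simp
  also have "\<dots> = \<B> \<Zcomp> (dot a \<Zcomp> (\<B> \<Zcomp> cpow A \<B> m))"
    by (simp only: dot_natural assms comb_closed) simp
  also have "\<dots> = (\<B> \<Zcomp> (\<B> \<cdot> a)) \<Zcomp> cpow A \<B> n"
    unfolding a by simp
  also have "\<dots> = (\<B> \<cdot> (\<B> \<cdot> a)) \<Zcomp> cpow A \<B> (Suc n)"
    by (simp only: B_natural assms) simp
  finally show ?thesis by (simp add: arity_iff del: cpow.simps)
qed

lemma arity_left:
  assumes "arity A a m n" "a \<in> carrier A"
  shows "arity A (cpow A \<B> k \<cdot> a) (k + m) (k + n)"
  using assms by (induction k) (auto simp: arity_shift)

text \<open>\<open>C_App_ccomp\<close> computes \<open>\<C> Plus \<cdot> \<I> \<Zcomp> f\<close> in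
  a form to which the arity of \<open>f\<close> applies; evaluation at \<open>\<I>\<close> gives the
  claim. This is what makes \<open>dot\<close> surjective onto the arrows from 0 to 1.\<close>

lemma arity_0_1_eq_dot:
  assumes "arity A f 0 (Suc 0)" "f \<in> carrier A"
  shows "f = dot (f \<cdot> \<I>)"
proof -
  note [simp] = assms(2)
  have "\<C> Plus \<cdot> \<I> \<Zcomp> f = \<C> Plus \<cdot> (\<C> Plus \<cdot> \<B> \<cdot> f)"
    by (simp add: C_App_ccomp)
  also have "\<C> Plus \<cdot> \<B> \<cdot> f = (\<B> \<cdot> f) \<Zcomp> \<B>"
    using assms by (simp add: C_App_App_eq_dot arity_iff)
  also have "\<C> Plus \<cdot> \<dots> = (\<B> \<cdot> f) \<Zcomp> (\<C> Plus \<cdot> \<B>)"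
    by (simp add: C_App_shift)
  finally have "(\<C> Plus \<cdot> \<I> \<Zcomp> f) \<cdot> \<I> = ((\<B> \<cdot> f) \<Zcomp> (\<C> Plus \<cdot> \<B>)) \<cdot> \<I>"
    by simp
  then show ?thesis
    by (simp add: dot_def C_B_I)
qed

text \<open>Extensionality: a closed arrow is determined by its effect on \<open>m\<close>
  arguments. Since \<open>f\<close> is some \<open>dot e\<close>, evaluating both sides at
  \<open>\<I>\<close> yields \<open>e\<close> and \<open>g\<close>.\<close>

lemma arity_0_1_unique:
  assumes "arity A f 0 (Suc 0)" "f \<in> carrier A" "g \<in> carrier A"
    and "f \<Zcomp> cpow A \<B> (Suc m) = (\<B> \<cdot> g) \<Zcomp> cpow A \<B> n"
  shows "f = dot g"
proof -
  define e where "e = f \<cdot> \<I>"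
  have e: "f = dot e" "e \<in> carrier A"
    using assms arity_0_1_eq_dot by (auto simp: e_def)
  have "(dot e \<Zcomp> cpow A \<B> (Suc m)) \<cdot> \<I> = ((\<B> \<cdot> g) \<Zcomp> cpow A \<B> n) \<cdot> \<I>"
    using assms e by simp
  then show ?thesis using assms(3) e by (simp add: dot_App)
qed

text \<open>With $\sigma^{\pm}$ the braid and its reverse, \<open>sig1 s n\<close> is $\sigma^s_{1,n}$ and
  \<open>sig1' s n\<close> is $\sigma^s_{n,1}$.\<close>

primrec sig1 :: "sign \<Rightarrow> nat \<Rightarrow> 'a" where
  "sig1 s 0 = \<I>"
| "sig1 s (Suc n) = \<C> s \<Zcomp> (\<B> \<cdot> sig1 s n)"

primrec sig1' :: "sign \<Rightarrow> nat \<Rightarrow> 'a" where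
  "sig1' s 0 = \<I>"
| "sig1' s (Suc n) = (\<B> \<cdot> sig1' s n) \<Zcomp> \<C> s"

lemma sig1_closed [simp, intro]: "sig1 s n \<in> carrier A"
  by (induction n) auto

lemma sig1'_closed [simp, intro]: "sig1' s n \<in> carrier A"
  by (induction n) auto

lemma arity_C': "arity A (\<C> s) (Suc (Suc n)) (Suc (Suc n))"
  using arity_right [OF arity_C, of s n] by simp

lemma arity_sig1 [simp]: "arity A (sig1 s n) (Suc n) (Suc n)"
  by (induction n) (auto intro!: arity_ccomp arity_shift simp: arity_C')

lemma arity_sig1' [simp]: "arity A (sig1' s n) (Suc n) (Suc n)"
  by (induction n) (auto intro!: arity_ccomp arity_shift simp: arity_C')

lemma sig1'_sig1: "sig1' s n \<Zcomp> sig1 (flip s) n = \<I>"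
  by (induction n) (auto simp: C_flip [THEN ccomp_tail2] B_cancel)

lemma sig1_sig1': "sig1 (flip s) n \<Zcomp> sig1' s n = \<I>"
  by (induction n) (auto simp: B_cancel [THEN ccomp_tail2])

lemma cpow_B_C_I: "cpow A \<B> n \<Zcomp> (\<C> s \<cdot> \<I>) = \<C> s \<cdot> sig1 s n"
  by (induction n) (auto simp: B_ccomp_C_App)

text \<open>\<open>\<C> s\<close> is injective, and by \<open>cpow_B_C_I\<close> it turns the braid
  on \<open>n\<close> wires into a power of \<open>\<B>\<close> followed by the fixed element
  \<open>\<C> s \<cdot> \<I>\<close>. On that power the arity of \<open>a\<close> can be
  used.\<close>

lemma sig1_natural:
  assumes "arity A a m n" "a \<in> carrier A"
  shows "(\<B> \<cdot> a) \<Zcomp> sig1 s n = sig1 s m \<Zcomp> a"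
proof (rule C_inject)
  note [simp] = assms(2)
  have a: "dot a \<Zcomp> cpow A \<B> (Suc m) = (\<B> \<cdot> a) \<Zcomp> cpow A \<B> n"
    using assms by (simp add: arity_iff)
  have "\<C> s \<cdot> ((\<B> \<cdot> a) \<Zcomp> sig1 s n) = ((\<B> \<cdot> a) \<Zcomp> cpow A \<B> n) \<Zcomp> (\<C> s \<cdot> \<I>)"
    by (simp add: C_App_shift cpow_B_C_I)
  also have "\<dots> = dot a \<Zcomp> (\<C> s \<cdot> sig1 s (Suc m))"
    unfolding a [symmetric] cpow_B_C_I [symmetric] by simp
  also have "\<dots> = \<C> (flip s) \<cdot> (\<C> s \<cdot> sig1 s (Suc m)) \<cdot> a"
    by (rule C_App_App_eq_dot [symmetric]) auto
  also have "\<dots> = \<C> s \<cdot> (sig1 s m \<Zcomp> a)"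
    by simp
  finally show "\<C> s \<cdot> ((\<B> \<cdot> a) \<Zcomp> sig1 s n) = \<C> s \<cdot> (sig1 s m \<Zcomp> a)" .
qed (use assms in auto)

text \<open>\<open>sig1' s\<close> is inverse to \<open>sig1 (flip s)\<close>, so the previous lemma
  is used at the opposite sign and conjugated.\<close>

lemma sig1'_natural:
  assumes "arity A a m n" "a \<in> carrier A"
  shows "a \<Zcomp> sig1' s n = sig1' s m \<Zcomp> (\<B> \<cdot> a)"
proof -
  note [simp] = assms(2)
  have "a \<Zcomp> sig1' s n = sig1' s m \<Zcomp> ((sig1 (flip s) m \<Zcomp> a) \<Zcomp> sig1' s n)"
    by (simp add: sig1'_sig1 [THEN ccomp_tail2])
  also have "\<dots> = sig1' s m \<Zcomp> (((\<B> \<cdot> a) \<Zcomp> sig1 (flip s) n) \<Zcomp> sig1' s n)"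
    by (simp only: sig1_natural [OF assms])
  also have "\<dots> = sig1' s m \<Zcomp> (\<B> \<cdot> a)"
    by (simp add: sig1_sig1')
  finally show ?thesis .
qed

lemma prob_braid_1_eq: "prob_braid_1 A m = sig1' Plus m"
  by (induction m) auto

abbreviation braid :: "nat \<Rightarrow> nat \<Rightarrow> 'a" where
  "braid \<equiv> prob_braid A"

lemma braid_Suc: "braid m (Suc n) = sig1' Plus m \<Zcomp> (\<B> \<cdot> braid m n)"
  by (simp add: prob_braid_1_eq)

declare prob_braid.simps(2) [simp del]
declare braid_Suc [simp]

lemma braid_closed [simp, intro]: "braid m n \<in> carrier A"
  by (induction n) auto

lemma braid_0_left [simp]: "braid 0 n = \<I>"
  by (induction n) auto

lemma braid_Suc_left: "braid (Suc m) n = (\<B> \<cdot> braid m n) \<Zcomp> sig1 Plus n"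
proof (induction n)
  case (Suc n)
  have "braid (Suc m) (Suc n)
      = (\<B> \<cdot> sig1' Plus m) \<Zcomp> ((\<C> Plus \<Zcomp> (\<B> \<cdot> (\<B> \<cdot> braid m n))) \<Zcomp> (\<B> \<cdot> sig1 Plus n))"
    by (simp add: Suc)
  also have "\<dots> = (\<B> \<cdot> braid m (Suc n)) \<Zcomp> sig1 Plus (Suc n)"
    by (simp only: C_commute braid_closed) simp
  finally show ?case .
qed simp

lemma braid_1_left: "braid (Suc 0) n = sig1 Plus n"
  by (simp only: braid_Suc_left) simp

lemma braid_1_right: "braid m (Suc 0) = sig1' Plus m"
  by simp

lemma arity_sig1_right: "arity A (sig1 s m) (Suc (m + n)) (Suc (m + n))"
  using arity_right [OF arity_sig1, of s m n] by simp

lemma arity_sig1'_right: "arity A (sig1' s m) (Suc (m + n)) (Suc (m + n))"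
  using arity_right [OF arity_sig1', of s m n] by simp

lemma arity_braid: "arity A (braid m n) (m + n) (n + m)"
proof (induction n)
  case (Suc n)
  show ?case
    using arity_sig1'_right [of Plus m n] arity_shift [OF Suc]
    by (auto intro!: arity_ccomp)
qed simp

primrec braid_inv :: "nat \<Rightarrow> nat \<Rightarrow> 'a" where
  "braid_inv m 0 = \<I>"
| "braid_inv m (Suc n) = (\<B> \<cdot> braid_inv m n) \<Zcomp> sig1 Minus m"

lemma braid_inv_closed [simp, intro]: "braid_inv m n \<in> carrier A"
  by (induction n) auto

lemma arity_braid_inv: "arity A (braid_inv m n) (n + m) (m + n)"
proof (induction n)
  case (Suc n)
  show ?case
    using arity_sig1_right [of Minus m n] arity_shift [OF Suc]
    by (auto intro!: arity_ccomp)
qed simp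

lemma braid_braid_inv: "braid m n \<Zcomp> braid_inv m n = \<I>"
proof (induction n)
  case (Suc n)
  then show ?case using sig1'_sig1 [of Plus m]
    by (simp add: B_cancel [THEN ccomp_tail2])
qed simp

lemma braid_inv_braid: "braid_inv m n \<Zcomp> braid m n = \<I>"
proof (induction n)
  case (Suc n)
  then show ?case using sig1_sig1' [of Plus m]
    by (simp add: B_cancel ccomp_tail2 [where z = \<I>])
qed simp

lemma braid_natural_left:
  assumes "arity A a m n" "a \<in> carrier A"
  shows "a \<Zcomp> braid n k = braid m k \<Zcomp> (cpow A \<B> k \<cdot> a)"
proof (induction k)
  case (Suc k)
  note [simp] = assms(2)
  have "a \<Zcomp> braid n (Suc k) = (a \<Zcomp> sig1' Plus n) \<Zcomp> (\<B> \<cdot> braid n k)"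
    by simp
  also have "\<dots> = sig1' Plus m \<Zcomp> (\<B> \<cdot> (a \<Zcomp> braid n k))"
    by (simp only: sig1'_natural [OF assms]) simp
  also have "\<dots> = braid m (Suc k) \<Zcomp> (cpow A \<B> (Suc k) \<cdot> a)"
    by (simp only: Suc) simp
  finally show ?case .
qed (use assms in simp)

lemma braid_natural_right:
  assumes "arity A b m n" "b \<in> carrier A"
  shows "(cpow A \<B> k \<cdot> b) \<Zcomp> braid k n = braid k m \<Zcomp> b"
proof (induction k)
  case (Suc k)
  note [simp] = assms(2)
  have "(cpow A \<B> (Suc k) \<cdot> b) \<Zcomp> braid (Suc k) n = (\<B> \<cdot> ((cpow A \<B> k \<cdot> b) \<Zcomp> braid k n)) \<Zcomp> sig1 Plus n"
    by (simp add: braid_Suc_left)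
  also have "\<dots> = (\<B> \<cdot> braid k m) \<Zcomp> ((\<B> \<cdot> b) \<Zcomp> sig1 Plus n)"
    by (simp only: Suc) simp
  also have "\<dots> = braid (Suc k) m \<Zcomp> b"
    by (simp only: sig1_natural [OF assms]) (simp add: braid_Suc_left)
  finally show ?case .
qed (use assms in simp)

lemma braid_add_left: "braid (x + y) z = (cpow A \<B> x \<cdot> braid y z) \<Zcomp> braid x z"
  by (induction x) (auto simp: braid_Suc_left)

lemma braid_add_right: "braid x (y + z) = braid x y \<Zcomp> (cpow A \<B> y \<cdot> braid x z)"
  by (induction y) auto

section \<open>The internal PROB as a braided strict monoidal category\<close>

definition cat :: "(nat, nat \<times> 'a \<times> nat) cat_data" where
  "cat = internal_prob A"

lemma cat_simps [simp]:
  "Obj cat = UNIV"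
  "Dom cat (m, a, n) = m" "Cod cat (m, a, n) = n"
  "Ide cat n = (n, \<I>, n)"
  "Seq cat (l, a, m) (m', b, n) = (l, a \<Zcomp> b, n)"
  "Unit cat = 0"
  "TensO cat m n = m + n"
  "TensM cat (m, a, n) (m', b, n') = (m + m', a \<Zcomp> (cpow A \<B> n \<cdot> b), n + n')"
  "Braid cat m n = (m + n, prob_braid A m n, n + m)"
  "Twist cat m = (m, prob_twist A m, m)"
  by (auto simp: cat_def internal_prob_def)

lemma Arr_cat [simp]: "(m, a, n) \<in> Arr cat \<longleftrightarrow> a \<in> carrier A \<and> arity A a m n"
  by (auto simp: cat_def internal_prob_def)

lemma hom_cat: "f \<in> hom cat m n \<longleftrightarrow> (\<exists>a. f = (m, a, n) \<and> a \<in> carrier A \<and> arity A a m n)"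
  by (cases f) (auto simp: hom_def)

lemma hom_catI [simp]: "(m, a, n) \<in> hom cat m' n' \<longleftrightarrow> m = m' \<and> n = n' \<and> a \<in> carrier A \<and> arity A a m n"
  by (auto simp: hom_cat)

lemma hom_catE:
  assumes "f \<in> hom cat m n"
  obtains a where "f = (m, a, n)" "a \<in> carrier A" "arity A a m n"
  using assms hom_cat by blast

lemma inverse_arrows_cat [simp]:
  "inverse_arrows cat (m, a, n) (n', b, m') \<longleftrightarrow>
    a \<in> carrier A \<and> b \<in> carrier A \<and> arity A a m n \<and> arity A b n m \<and>
    m' = m \<and> n' = n \<and> a \<Zcomp> b = \<I> \<and> b \<Zcomp> a = \<I>"
  by (auto simp: inverse_arrows_def)

lemma arity_tensor:
  assumes "arity A a m n" "arity A b m' n'" "a \<in> carrier A" "b \<in> carrier A"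
  shows "arity A (a \<Zcomp> (cpow A \<B> n \<cdot> b)) (m + m') (n + n')"
  using assms by (intro arity_ccomp [of _ _ "n + m'"] arity_left arity_right) auto

lemma category_cat: "category cat"
proof
  fix f assume "f \<in> Arr cat"
  show "Dom cat f \<in> Obj cat" "Cod cat f \<in> Obj cat" by auto
qed (auto elim!: hom_catE intro: arity_ccomp)

lemma strict_monoidal_category_cat: "strict_monoidal_category cat"
proof -
  interpret category cat by (rule category_cat)
  show ?thesis
  proof
    fix f g :: "nat \<times> 'a \<times> nat" and X Y X' Y'
    assume "f \<in> hom cat X Y" "g \<in> hom cat X' Y'"
    then show "TensM cat f g \<in> hom cat (TensO cat X X') (TensO cat Y Y')"
      by (auto elim!: hom_catE intro: arity_tensor)
  next
    fix f g f' g' :: "nat \<times> 'a \<times> nat" and X Y Z X' Y' Z'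
    assume "f \<in> hom cat X Y" "g \<in> hom cat Y Z" "f' \<in> hom cat X' Y'" "g' \<in> hom cat Y' Z'"
    then show "TensM cat (Seq cat f g) (Seq cat f' g') = Seq cat (TensM cat f f') (TensM cat g g')"
      by (auto elim!: hom_catE simp: interchange interchange [THEN ccomp_tail2])
  next
    fix f g h :: "nat \<times> 'a \<times> nat"
    assume "f \<in> Arr cat" "g \<in> Arr cat" "h \<in> Arr cat"
    then show "TensM cat (TensM cat f g) h = TensM cat f (TensM cat g h)"
      by (cases f; cases g; cases h) (auto simp: cpow_B_add_App)
  next
    fix f :: "nat \<times> 'a \<times> nat"
    assume "f \<in> Arr cat"
    then show "TensM cat (Ide cat (Unit cat)) f = f" "TensM cat f (Ide cat (Unit cat)) = f"
      by (cases f; auto)+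
  qed auto
qed

lemma braided_cat: "braided_strict_monoidal_category cat"
proof -
  interpret strict_monoidal_category cat by (rule strict_monoidal_category_cat)
  show ?thesis
  proof
    fix X Y
    show "Braid cat X Y \<in> hom cat (TensO cat X Y) (TensO cat Y X)"
      by (simp add: arity_braid)
    have "inverse_arrows cat (Braid cat X Y) (Y + X, braid_inv X Y, X + Y)"
      by (simp add: arity_braid arity_braid_inv braid_braid_inv braid_inv_braid)
    then show "iso_arrow cat (Braid cat X Y)"
      unfolding iso_arrow_def by blast
  next
    fix f g :: "nat \<times> 'a \<times> nat" and X Y X' Y'
    assume "f \<in> hom cat X Y" "g \<in> hom cat X' Y'"
    then obtain a b where f: "f = (X, a, Y)" "arity A a X Y" and g: "g = (X', b, Y')" "arity A b X' Y'"
      and [simp]: "a \<in> carrier A" "b \<in> carrier A"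
      by (auto elim!: hom_catE)
    have "a \<Zcomp> ((cpow A \<B> Y \<cdot> b) \<Zcomp> braid Y Y') = (a \<Zcomp> braid Y X') \<Zcomp> b"
      by (simp add: braid_natural_right [OF g(2)])
    also have "\<dots> = braid X X' \<Zcomp> ((cpow A \<B> X' \<cdot> a) \<Zcomp> b)"
      by (simp add: braid_natural_left [OF f(2)])
    also have "\<dots> = braid X X' \<Zcomp> (b \<Zcomp> (cpow A \<B> Y' \<cdot> a))"
      by (simp add: interchange [OF g(2)])
    finally show "Seq cat (TensM cat f g) (Braid cat Y Y') = Seq cat (Braid cat X X') (TensM cat g f)"
      by (simp add: f g)
  next
    fix X Y Z
    show "Braid cat (TensO cat X Y) Z
        = Seq cat (TensM cat (Ide cat X) (Braid cat Y Z)) (TensM cat (Braid cat X Z) (Ide cat Y))"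
      by (simp add: braid_add_left)
    show "Braid cat X (TensO cat Y Z)
        = Seq cat (TensM cat (Braid cat X Y) (Ide cat Z)) (TensM cat (Ide cat Y) (Braid cat X Z))"
      by (simp add: braid_add_right)
  qed
qed

subsection \<open>Naturality of the twist\<close>

abbreviation twist :: "nat \<Rightarrow> 'a" where
  "twist \<equiv> prob_twist A"

lemma twist_Suc: "twist (Suc n) = \<Theta> Plus \<Zcomp> (sig1 Plus n \<Zcomp> (twist n \<Zcomp> sig1' Plus n))"
proof (cases n)
  case (Suc m)
  have "braid (Suc 0) (Suc m) = sig1 Plus (Suc m)" by (rule braid_1_left)
  moreover have "braid (Suc m) (Suc 0) = sig1' Plus (Suc m)" by (rule braid_1_right)
  ultimately show ?thesis by (simp only: Suc prob_twist.simps One_nat_def)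
qed simp

declare prob_twist.simps(2,3) [simp del]

lemma twist_closed [simp, intro]: "twist n \<in> carrier A"
  by (induction n) (auto simp: twist_Suc)

lemma arity_Theta': "arity A (\<Theta> s) (Suc n) (Suc n)"
  using arity_right [OF arity_Theta, of s n] by simp

lemma arity_twist: "arity A (twist n) n n"
proof (induction n)
  case (Suc n)
  have "arity A (twist n) (Suc n) (Suc n)"
    using arity_right [OF Suc, of 1] by simp
  then show ?case
    by (auto simp: twist_Suc intro!: arity_ccomp [where m = "Suc n"] arity_Theta')
qed simp

text \<open>The pure braid that takes the first wire once around the other \<open>n\<close>
  wires.\<close>

definition full_braid :: "nat \<Rightarrow> 'a" where
  "full_braid n = sig1 Plus n \<Zcomp> sig1' Plus n"

lemma full_braid_closed [simp, intro]: "full_braid n \<in> carrier A"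
  by (simp add: full_braid_def)

lemma arity_full_braid: "arity A (full_braid n) (Suc n) (Suc n)"
  by (auto simp: full_braid_def intro!: arity_ccomp [where m = "Suc n"])

lemma full_braid_natural:
  assumes "arity A a m n" "a \<in> carrier A"
  shows "(\<B> \<cdot> a) \<Zcomp> full_braid n = full_braid m \<Zcomp> (\<B> \<cdot> a)"
  using assms
  by (simp add: full_braid_def sig1_natural [OF assms, THEN ccomp_tail2] sig1'_natural [OF assms])

lemma full_braid_add: "full_braid (m + n) =
    sig1 Plus m \<Zcomp> ((cpow A \<B> m \<cdot> full_braid n) \<Zcomp> sig1' Plus m)"
proof -
  have "sig1 Plus (m + n) = sig1 Plus m \<Zcomp> (cpow A \<B> m \<cdot> sig1 Plus n)"
    using braid_add_right [of "Suc 0" m n] by (simp only: braid_1_left)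
  moreover have "sig1' Plus (m + n) = (cpow A \<B> m \<cdot> sig1' Plus n) \<Zcomp> sig1' Plus m"
    using braid_add_left [of m n "Suc 0"] by (simp only: braid_1_right)
  ultimately show ?thesis by (simp add: full_braid_def)
qed

lemma twist_Suc': "twist (Suc n) = \<Theta> Plus \<Zcomp> ((\<B> \<cdot> twist n) \<Zcomp> full_braid n)"
  unfolding twist_Suc full_braid_def
  by (simp add: sig1_natural [OF arity_twist, THEN ccomp_tail2])

text \<open>The first wire may circle both blocks at once after they have been braided around each
  other, or circle each block separately in between. This is the geometric content of the induction
  step of \<open>twist_add'\<close>.\<close>

lemma full_braid_hexagon:
  "(\<B> \<cdot> braid m n) \<Zcomp> ((\<B> \<cdot> braid n m) \<Zcomp> full_braid (m + n)) =
    full_braid m \<Zcomp> ((\<B> \<cdot> braid m n) \<Zcomp> (full_braid n \<Zcomp> (\<B> \<cdot> braid n m)))"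
proof -
  have "(\<B> \<cdot> braid m n) \<Zcomp> ((\<B> \<cdot> braid n m) \<Zcomp> full_braid (m + n)) =
      ((\<B> \<cdot> braid m n) \<Zcomp> full_braid (n + m)) \<Zcomp> (\<B> \<cdot> braid n m)"
    by (simp add: full_braid_natural [OF arity_braid [of n m]])
  also have "(\<B> \<cdot> braid m n) \<Zcomp> full_braid (n + m) =
      (braid (Suc m) n \<Zcomp> (cpow A \<B> n \<cdot> full_braid m)) \<Zcomp> sig1' Plus n"
    unfolding full_braid_add by (simp add: braid_Suc_left)
  also have "\<dots> = full_braid m \<Zcomp> (braid (Suc m) n \<Zcomp> sig1' Plus n)"
    by (simp add: braid_natural_left [OF arity_full_braid, THEN ccomp_tail2])
  also have "\<dots> = full_braid m \<Zcomp> ((\<B> \<cdot> braid m n) \<Zcomp> full_braid n)"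
    by (simp add: braid_Suc_left full_braid_def)
  finally show ?thesis by simp
qed

text \<open>The twists are collected in front of the double braiding, a form suited to induction on
  \<open>m\<close> and to sliding an arrow through.\<close>

lemma twist_add': "twist (m + n) =
    twist m \<Zcomp> ((cpow A \<B> m \<cdot> twist n) \<Zcomp> (braid m n \<Zcomp> braid n m))"
proof (induction m)
  case (Suc m)
  have "twist (Suc m + n) = \<Theta> Plus \<Zcomp> ((\<B> \<cdot> twist (m + n)) \<Zcomp> full_braid (m + n))"
    by (simp add: twist_Suc')
  also have "\<dots> = \<Theta> Plus \<Zcomp> ((\<B> \<cdot> twist m) \<Zcomp> ((cpow A \<B> (Suc m) \<cdot> twist n) \<Zcomp>
      ((\<B> \<cdot> braid m n) \<Zcomp> ((\<B> \<cdot> braid n m) \<Zcomp> full_braid (m + n)))))"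
    unfolding Suc by simp
  also have "\<dots> = \<Theta> Plus \<Zcomp> ((\<B> \<cdot> twist m) \<Zcomp> (((cpow A \<B> (Suc m) \<cdot> twist n) \<Zcomp> full_braid m) \<Zcomp>
      ((\<B> \<cdot> braid m n) \<Zcomp> (full_braid n \<Zcomp> (\<B> \<cdot> braid n m)))))"
    unfolding full_braid_hexagon by simp
  also have "(cpow A \<B> (Suc m) \<cdot> twist n) \<Zcomp> full_braid m = full_braid m \<Zcomp> (cpow A \<B> (Suc m) \<cdot> twist n)"
    by (rule interchange [OF arity_full_braid, symmetric]) auto
  finally show ?case
    by (simp add: twist_Suc' braid_Suc_left)
      (simp add: full_braid_def)
qed simp

lemma twist_add: "twist (m + n) =
    braid m n \<Zcomp> (twist n \<Zcomp> ((cpow A \<B> n \<cdot> twist m) \<Zcomp> braid n m))"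
proof -
  have "twist (m + n) = twist m \<Zcomp> (((cpow A \<B> m \<cdot> twist n) \<Zcomp> braid m n) \<Zcomp> braid n m)"
    by (simp add: twist_add')
  also have "\<dots> = (twist m \<Zcomp> braid m n) \<Zcomp> (twist n \<Zcomp> braid n m)"
    by (simp only: braid_natural_right [OF arity_twist [of n], of m] twist_closed) simp
  also have "\<dots> = braid m n \<Zcomp> (((cpow A \<B> n \<cdot> twist m) \<Zcomp> twist n) \<Zcomp> braid n m)"
    by (simp only: braid_natural_left [OF arity_twist [of m], of n] twist_closed) simp
  also have "(cpow A \<B> n \<cdot> twist m) \<Zcomp> twist n = twist n \<Zcomp> (cpow A \<B> n \<cdot> twist m)"
    by (rule interchange [OF arity_twist, symmetric]) auto
  finally show ?thesis by simp
qed

text \<open>Idle wires on the right do not change \<open>a\<close>. Hence the axioms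
  \<open>Theta_B\<close> and \<open>Theta_app\<close>, which state naturality for
  \<open>\<B>\<close> and \<open>dot a\<close> on the fewest wires, extend to any number of
  wires.\<close>

lemma twist_natural_right:
  assumes "arity A a m n" "a \<in> carrier A" "a \<Zcomp> twist n = twist m \<Zcomp> a"
  shows "a \<Zcomp> twist (n + k) = twist (m + k) \<Zcomp> a"
proof -
  note [simp] = assms(2)
  have "a \<Zcomp> twist (n + k) = (a \<Zcomp> twist n) \<Zcomp> ((cpow A \<B> n \<cdot> twist k) \<Zcomp> (braid n k \<Zcomp> braid k n))"
    by (simp add: twist_add')
  also have "\<dots> = twist m \<Zcomp> ((a \<Zcomp> (cpow A \<B> n \<cdot> twist k)) \<Zcomp> (braid n k \<Zcomp> braid k n))"
    unfolding assms(3) by simp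
  also have "\<dots> = twist m \<Zcomp> ((cpow A \<B> m \<cdot> twist k) \<Zcomp> ((a \<Zcomp> braid n k) \<Zcomp> braid k n))"
    by (simp only: interchange [OF assms(1)] assms(2) twist_closed) simp
  also have "\<dots> = twist m \<Zcomp> ((cpow A \<B> m \<cdot> twist k) \<Zcomp> (braid m k \<Zcomp> ((cpow A \<B> k \<cdot> a) \<Zcomp> braid k n)))"
    by (simp only: braid_natural_left [OF assms(1)] assms(2)) simp
  also have "\<dots> = twist (m + k) \<Zcomp> a"
    by (simp only: braid_natural_right [OF assms(1)] assms(2)) (simp add: twist_add')
  finally show ?thesis .
qed

lemma twist_1 [simp]: "twist (Suc 0) = \<Theta> Plus"
  by (simp add: twist_Suc)

lemma twist_2: "twist (Suc (Suc 0)) = \<Theta> Plus \<Zcomp> (\<C> Plus \<Zcomp> (\<Theta> Plus \<Zcomp> \<C> Plus))"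
  by (simp add: twist_Suc [of "Suc 0"])

lemma B_twist: "\<B> \<Zcomp> twist (Suc k) = twist (Suc (Suc k)) \<Zcomp> \<B>"
proof -
  have "\<B> \<Zcomp> twist (Suc 0) = twist 2 \<Zcomp> \<B>"
    using Theta_B [of Plus] by (simp add: numeral_2_eq_2 twist_2)
  from twist_natural_right [OF arity_B _ this, of k] show ?thesis by simp
qed

lemma dot_Theta: "a \<in> carrier A \<Longrightarrow> dot a \<Zcomp> \<Theta> s = dot a"
  using Theta_app [of a Plus s Plus] by (simp add: C_App_App_eq_dot)

lemma dot_twist:
  assumes "a \<in> carrier A"
  shows "dot a \<Zcomp> twist (Suc k) = twist k \<Zcomp> dot a"
proof -
  have "dot a \<Zcomp> twist (Suc 0) = twist 0 \<Zcomp> dot a"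
    using assms by (simp add: dot_Theta)
  from twist_natural_right [OF arity_dot [OF assms] _ this, of k] assms show ?thesis by simp
qed

lemma cpow_B_twist: "cpow A \<B> n \<Zcomp> twist (Suc k) = twist (n + Suc k) \<Zcomp> cpow A \<B> n"
proof (induction n)
  case (Suc n)
  have "cpow A \<B> (Suc n) \<Zcomp> twist (Suc k) = \<B> \<Zcomp> (cpow A \<B> n \<Zcomp> twist (Suc k))"
    by simp
  also have "\<dots> = (\<B> \<Zcomp> twist (Suc (n + k))) \<Zcomp> cpow A \<B> n"
    unfolding Suc by simp
  also have "\<dots> = twist (Suc n + Suc k) \<Zcomp> cpow A \<B> (Suc n)"
    unfolding B_twist by simp
  finally show ?case .
qed simp

primrec twist_inv :: "nat \<Rightarrow> 'a" where
  "twist_inv 0 = \<I>"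
| "twist_inv (Suc n) = sig1 Minus n \<Zcomp> (twist_inv n \<Zcomp> (sig1' Minus n \<Zcomp> \<Theta> Minus))"

lemma twist_inv_closed [simp, intro]: "twist_inv n \<in> carrier A"
  by (induction n) auto

lemma sig1_inverses:
  "sig1 Plus n \<Zcomp> sig1' Minus n = \<I>" "sig1 Minus n \<Zcomp> sig1' Plus n = \<I>"
  "sig1' Plus n \<Zcomp> sig1 Minus n = \<I>" "sig1' Minus n \<Zcomp> sig1 Plus n = \<I>"
  using sig1_sig1' [of Plus] sig1_sig1' [of Minus] sig1'_sig1 [of Plus] sig1'_sig1 [of Minus] by auto

lemma arity_twist_inv: "arity A (twist_inv n) n n"
proof (induction n)
  case (Suc n)
  have "arity A (twist_inv n) (Suc n) (Suc n)"
    using arity_right [OF Suc, of 1] by simp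
  then show ?case
    by (auto intro!: arity_ccomp [where m = "Suc n"] arity_Theta')
qed simp

lemma twist_twist_inv: "twist n \<Zcomp> twist_inv n = \<I>"
  by (induction n) (auto simp: twist_Suc sig1_inverses ccomp_tail2 [where z = \<I>])

lemma twist_inv_twist: "twist_inv n \<Zcomp> twist n = \<I>"
  by (induction n) (auto simp: twist_Suc sig1_inverses ccomp_tail2 [where z = \<I>])

text \<open>The element \<open>a\<close> can be read off \<open>(\<B> \<cdot> a) \<Zcomp> cpow A \<B> n\<close>, which the arity
  of \<open>a\<close> expresses by \<open>dot a\<close> and \<open>\<B>\<close>; hence naturality for these two suffices.\<close>

lemma twist_natural:
  assumes "arity A a m n" "a \<in> carrier A"
  shows "a \<Zcomp> twist n = twist m \<Zcomp> a"
proof -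
  note [simp] = assms(2)
  have a: "dot a \<Zcomp> cpow A \<B> (Suc m) = (\<B> \<cdot> a) \<Zcomp> cpow A \<B> n"
    using assms by (simp add: arity_iff del: cpow.simps)
  \<comment> \<open>\<open>?K\<close> is what remains of
    \<open>twist (Suc n) \<Zcomp> cpow A \<B> n\<close> when the factor
    \<open>\<B> \<cdot> twist n\<close> is split off; by naturality at powers of \<open>\<B>\<close>
    the whole is \<open>cpow A \<B> n \<Zcomp> \<Theta> Plus\<close>.\<close>
  let ?K = "\<Theta> Plus \<Zcomp> (full_braid n \<Zcomp> cpow A \<B> n)"
  have K: "(\<B> \<cdot> twist n) \<Zcomp> ?K = cpow A \<B> n \<Zcomp> \<Theta> Plus"
  proof -
    have "(\<B> \<cdot> twist n) \<Zcomp> ?K = twist (Suc n) \<Zcomp> cpow A \<B> n"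
      by (simp add: twist_Suc' Theta_natural [THEN ccomp_tail2])
    also have "\<dots> = cpow A \<B> n \<Zcomp> \<Theta> Plus"
      using cpow_B_twist [of n 0] by simp
    finally show ?thesis .
  qed
  have "(\<B> \<cdot> a) \<Zcomp> ((\<B> \<cdot> twist n) \<Zcomp> ?K) = ((\<B> \<cdot> a) \<Zcomp> cpow A \<B> n) \<Zcomp> \<Theta> Plus"
    unfolding K by simp
  also have "\<dots> = dot a \<Zcomp> (cpow A \<B> (Suc m) \<Zcomp> twist (Suc 0))"
    unfolding a [symmetric] by simp
  also have "\<dots> = (dot a \<Zcomp> twist (Suc (Suc m))) \<Zcomp> cpow A \<B> (Suc m)"
    unfolding cpow_B_twist by simp
  also have "\<dots> = twist (Suc m) \<Zcomp> (dot a \<Zcomp> cpow A \<B> (Suc m))"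
    by (simp only: dot_twist assms) simp
  also have "\<dots> = \<Theta> Plus \<Zcomp> ((\<B> \<cdot> twist m) \<Zcomp> ((full_braid m \<Zcomp> (\<B> \<cdot> a)) \<Zcomp> cpow A \<B> n))"
    unfolding a by (simp add: twist_Suc')
  also have "\<dots> = (\<B> \<cdot> twist m) \<Zcomp> ((\<B> \<cdot> a) \<Zcomp> ?K)"
    by (simp add: full_braid_natural [OF assms, symmetric] Theta_natural [THEN ccomp_tail2])
  \<comment> \<open>Solving for \<open>?K\<close> puts both sides in front of the same tail.
    Removing the twist and evaluating at \<open>\<I>\<close> then reads off
    \<open>a\<close>.\<close>
  also have "?K = (\<B> \<cdot> twist_inv n) \<Zcomp> (cpow A \<B> n \<Zcomp> \<Theta> Plus)"
    unfolding K [symmetric] by (simp add: B_cancel [THEN ccomp_tail2] twist_inv_twist)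
  finally have "((\<B> \<cdot> a) \<Zcomp> (cpow A \<B> n \<Zcomp> \<Theta> Plus)) \<Zcomp> \<Theta> Minus =
      ((\<B> \<cdot> twist m) \<Zcomp> ((\<B> \<cdot> a) \<Zcomp> ((\<B> \<cdot> twist_inv n) \<Zcomp> (cpow A \<B> n \<Zcomp> \<Theta> Plus)))) \<Zcomp> \<Theta> Minus"
    by (simp add: B_cancel [THEN ccomp_tail2] twist_twist_inv)
  then have "(\<B> \<cdot> a) \<Zcomp> cpow A \<B> n = (\<B> \<cdot> (twist m \<Zcomp> (a \<Zcomp> twist_inv n))) \<Zcomp> cpow A \<B> n"
    by simp
  then have "((\<B> \<cdot> a) \<Zcomp> cpow A \<B> n) \<cdot> \<I> = ((\<B> \<cdot> (twist m \<Zcomp> (a \<Zcomp> twist_inv n))) \<Zcomp> cpow A \<B> n) \<cdot> \<I>"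
    by simp
  then have "a = twist m \<Zcomp> (a \<Zcomp> twist_inv n)"
    by simp
  then have "a \<Zcomp> twist n = (twist m \<Zcomp> (a \<Zcomp> twist_inv n)) \<Zcomp> twist n"
    by simp
  then show ?thesis by (simp add: twist_inv_twist)
qed

subsection \<open>The trace operator and the beta and eta laws\<close>

text \<open>\<open>\<T> \<cdot> x\<close> is thought of as \<open>x\<close> with its first input and
  output joined in a loop. This rule and \<open>Tr_App_left\<close> are the tightening laws of that
  trace.\<close>

lemma Tr_App_right:
  assumes "x \<in> carrier A" "y \<in> carrier A"
  shows "\<T> \<cdot> (x \<Zcomp> (\<B> \<cdot> y)) = (\<T> \<cdot> x) \<Zcomp> y"
  using assms arg_cong [OF Tr_natural [of Plus], of "\<lambda>z. z \<cdot> x \<cdot> y"] by (simp add: C_app)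

lemma Tr_App_left:
  assumes "x \<in> carrier A" "y \<in> carrier A"
  shows "\<T> \<cdot> ((\<B> \<cdot> x) \<Zcomp> y) = x \<Zcomp> (\<T> \<cdot> y)"
  using assms arg_cong [OF Tr_natural' [of x], of "\<lambda>z. z \<cdot> y"] by simp

text \<open>The beta law: abstracting, running \<open>x\<close> under the abstraction and applying
  closes the loop of \<open>x\<close>.\<close>

lemma Tr_B:
  assumes "x \<in> carrier A"
  shows "\<T> \<Zcomp> ((\<B> \<cdot> x) \<Zcomp> \<B>) = \<B> \<cdot> (\<T> \<cdot> x)"
  using assms arg_cong [OF Tr_natural [of Plus], of "\<lambda>z. z \<cdot> x"] by (simp add: C_app)

lemma Tr_C_B: "\<T> \<Zcomp> ((\<B> \<cdot> \<C> s) \<Zcomp> \<B>) = \<B> \<cdot> \<Theta> s"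
  by (simp add: Tr_B Tr_yank)

lemma arity_Tr_App:
  assumes "arity A a (Suc m) (Suc n)" "a \<in> carrier A"
  shows "arity A (\<T> \<cdot> a) m n"
proof -
  note [simp] = assms(2)
  have a: "dot a \<Zcomp> (\<B> \<Zcomp> (\<B> \<Zcomp> cpow A \<B> m)) = (\<B> \<cdot> a) \<Zcomp> (\<B> \<Zcomp> cpow A \<B> n)"
    using assms by (simp add: arity_iff)
  have T: "dot \<T> \<Zcomp> (\<B> \<Zcomp> \<B>) = (\<B> \<cdot> \<T>) \<Zcomp> (\<B> \<Zcomp> \<B>)"
    using arity_Tr by (simp add: arity_iff numeral_2_eq_2 del: arity_Tr)
  have "dot (\<T> \<cdot> a) \<Zcomp> cpow A \<B> (Suc m) = dot a \<Zcomp> ((dot \<T> \<Zcomp> (\<B> \<Zcomp> \<B>)) \<Zcomp> cpow A \<B> m)"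
    by (simp add: dot_of_App)
  also have "\<dots> = (dot a \<Zcomp> (\<B> \<cdot> \<T>)) \<Zcomp> (\<B> \<Zcomp> (\<B> \<Zcomp> cpow A \<B> m))"
    unfolding T by simp
  also have "\<dots> = \<T> \<Zcomp> (dot a \<Zcomp> (\<B> \<Zcomp> (\<B> \<Zcomp> cpow A \<B> m)))"
    by (simp only: dot_natural assms comb_closed) simp
  also have "\<dots> = (\<T> \<Zcomp> ((\<B> \<cdot> a) \<Zcomp> \<B>)) \<Zcomp> cpow A \<B> n"
    unfolding a by simp
  also have "\<dots> = (\<B> \<cdot> (\<T> \<cdot> a)) \<Zcomp> cpow A \<B> n"
    by (simp only: Tr_B assms)
  finally show ?thesis by (simp add: arity_iff)
qed

lemma arity_B': "arity A \<B> (Suc (Suc n)) (Suc n)"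
  using arity_right [OF arity_B, of n] by simp

lemma arity_Tr': "arity A \<T> (Suc n) (Suc (Suc n))"
  using arity_right [OF arity_Tr, of n] by simp

lemmas arity_intros = arity_Tr_App arity_ccomp arity_shift arity_B' arity_Tr' arity_C' arity_Theta'

lemma C_Theta: "\<C> s \<Zcomp> \<Theta> t = (\<B> \<cdot> \<Theta> t) \<Zcomp> \<C> s"
  using sig1_natural [OF arity_Theta, of t s] by simp

lemma Theta_C: "\<Theta> t \<Zcomp> \<C> s = \<C> s \<Zcomp> (\<B> \<cdot> \<Theta> t)"
  using sig1'_natural [OF arity_Theta, of t s] by simp

lemma Tr_C1: "(\<B> \<cdot> \<T>) \<Zcomp> (\<C> s \<Zcomp> (\<B> \<cdot> \<C> s)) = \<C> s \<Zcomp> \<T>"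
  using sig1_natural [OF arity_Tr, of s] by (simp add: numeral_2_eq_2)

lemma Tr_C1': "(\<B> \<cdot> \<T>) \<Zcomp> \<C> s = \<C> s \<Zcomp> (\<T> \<Zcomp> (\<B> \<cdot> \<C> (flip s)))"
  using arg_cong [OF Tr_C1 [of s], of "\<lambda>x. x \<Zcomp> (\<B> \<cdot> \<C> (flip s))"] by (simp add: B_cancel)

lemma Tr_C2: "\<T> \<Zcomp> ((\<B> \<cdot> \<C> s) \<Zcomp> \<C> s) = \<C> s \<Zcomp> (\<B> \<cdot> \<T>)"
  using sig1'_natural [OF arity_Tr, of s] by (simp add: numeral_2_eq_2)

lemma C_B_shift: "\<C> s \<Zcomp> (\<B> \<cdot> \<B>) = (\<B> \<cdot> \<C> (flip s)) \<Zcomp> (\<B> \<Zcomp> \<C> s)"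
  by (simp add: B_ccomp_C B_cancel [THEN ccomp_tail2])

text \<open>The braid relation with one crossing reversed, obtained from \<open>C_braid\<close> by
  cancelling a crossing.\<close>

lemma C_braid_mixed1:
  "\<C> (flip s) \<Zcomp> ((\<B> \<cdot> \<C> s) \<Zcomp> \<C> s) = (\<B> \<cdot> \<C> s) \<Zcomp> (\<C> s \<Zcomp> (\<B> \<cdot> \<C> (flip s)))"
proof -
  have "\<C> (flip s) \<Zcomp> ((\<B> \<cdot> \<C> s) \<Zcomp> \<C> s) =
      \<C> (flip s) \<Zcomp> (((\<B> \<cdot> \<C> s) \<Zcomp> (\<C> s \<Zcomp> (\<B> \<cdot> \<C> s))) \<Zcomp> (\<B> \<cdot> \<C> (flip s)))"
    by (simp add: B_cancel)
  also have "\<dots> = (\<B> \<cdot> \<C> s) \<Zcomp> (\<C> s \<Zcomp> (\<B> \<cdot> \<C> (flip s)))"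
    unfolding C_braid by (simp add: flip_C [THEN ccomp_tail2])
  finally show ?thesis .
qed

lemma C_braid_mixed2:
  "(\<B> \<cdot> \<C> (flip s)) \<Zcomp> (\<C> s \<Zcomp> (\<B> \<cdot> \<C> s)) = \<C> s \<Zcomp> ((\<B> \<cdot> \<C> s) \<Zcomp> \<C> (flip s))"
proof -
  have "\<C> s \<Zcomp> ((\<B> \<cdot> \<C> s) \<Zcomp> \<C> (flip s)) =
      (\<B> \<cdot> \<C> (flip s)) \<Zcomp> (((\<B> \<cdot> \<C> s) \<Zcomp> (\<C> s \<Zcomp> (\<B> \<cdot> \<C> s))) \<Zcomp> \<C> (flip s))"
    by (simp add: B_cancel [THEN ccomp_tail2])
  also have "\<dots> = (\<B> \<cdot> \<C> (flip s)) \<Zcomp> (\<C> s \<Zcomp> (\<B> \<cdot> \<C> s))"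
    unfolding C_braid by simp
  finally show ?thesis by simp
qed

lemma Tr_C_BB: "\<T> \<Zcomp> (\<C> s \<Zcomp> (\<B> \<cdot> \<B>)) = (\<B> \<cdot> \<Theta> (flip s)) \<Zcomp> \<C> s"
  by (simp add: C_B_shift Tr_C_B [THEN ccomp_tail3])

text \<open>The combinator \<open>r\<close> sends \<open>y\<close> to \<open>\<lambda>x. y x\<close>, and \<open>G\<close> below is
  \<open>\<lambda>y x. y x\<close>. Being closed, \<open>G\<close> equals \<open>dot \<I>\<close> by extensionality of \<open>arity_0_1_unique\<close>.\<close>

lemma Tr_eta: "\<T> \<cdot> (\<C> (flip s) \<Zcomp> (\<B> \<Zcomp> (\<T> \<Zcomp> \<C> s))) = \<I>"
proof -
  define r where "r = \<T> \<cdot> (\<C> (flip s) \<Zcomp> (\<B> \<Zcomp> (\<T> \<Zcomp> \<C> s)))"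
  have [simp]: "r \<in> carrier A" by (simp add: r_def)
  have r: "arity A r (Suc 0) (Suc 0)"
    unfolding r_def by (rule arity_intros | simp)+
  have rC: "r \<Zcomp> \<C> Plus = \<C> Plus \<Zcomp> (\<B> \<cdot> r)"
    using sig1'_natural [OF r, of Plus] by simp
  have rB: "r \<Zcomp> (\<B> \<cdot> x) = (\<B> \<cdot> x) \<Zcomp> r" if "x \<in> carrier A" for x
    using interchange [OF r _ that] that by simp
  define G where "G = \<T> \<cdot> (r \<Zcomp> (\<T> \<Zcomp> \<C> Plus))"
  have [simp]: "G \<in> carrier A" by (simp add: G_def)
  have G: "arity A G 0 (Suc 0)"
    unfolding G_def by (rule arity_intros r | simp)+
  have "G \<Zcomp> \<B> = \<T> \<cdot> (r \<Zcomp> (\<T> \<Zcomp> (\<C> Plus \<Zcomp> (\<B> \<cdot> \<B>))))"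
    unfolding G_def by (simp add: Tr_App_right [symmetric])
  also have "\<dots> = \<T> \<cdot> ((\<B> \<cdot> \<Theta> Minus) \<Zcomp> (\<C> Plus \<Zcomp> (\<B> \<cdot> r)))"
    by (simp add: Tr_C_BB rB [THEN ccomp_tail2] rC)
  also have "\<dots> = \<Theta> Minus \<Zcomp> (\<Theta> Plus \<Zcomp> r)"
    by (simp add: Tr_App_left Tr_App_right Tr_yank)
  also have "\<dots> = r"
    by (simp add: Theta_Plus_Minus [THEN ccomp_tail2])
  finally have GB: "G \<Zcomp> \<B> = r" .
  have "r \<Zcomp> \<B> = \<T> \<cdot> (\<C> (flip s) \<Zcomp> (\<B> \<Zcomp> (\<T> \<Zcomp> (\<C> s \<Zcomp> (\<B> \<cdot> \<B>)))))"
    unfolding r_def by (simp add: Tr_App_right [symmetric])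
  also have "\<dots> = \<T> \<cdot> (\<C> (flip s) \<Zcomp> (\<B> \<Zcomp> ((\<B> \<cdot> \<Theta> (flip s)) \<Zcomp> \<C> s)))"
    by (simp add: Tr_C_BB)
  also have "\<dots> = \<T> \<cdot> ((\<B> \<cdot> (\<B> \<cdot> \<Theta> (flip s))) \<Zcomp> (\<C> (flip s) \<Zcomp> ((\<B> \<cdot> \<C> s) \<Zcomp> (\<C> s \<Zcomp> (\<B> \<cdot> \<B>)))))"
    by (simp add: B_natural [THEN ccomp_tail2] C_commute [THEN ccomp_tail2] B_ccomp_C)
  also have "\<dots> = \<T> \<cdot> ((\<B> \<cdot> (\<B> \<cdot> \<Theta> (flip s))) \<Zcomp> ((\<B> \<cdot> \<C> s) \<Zcomp> (\<C> s \<Zcomp> (\<B> \<cdot> (\<C> (flip s) \<Zcomp> \<B>)))))"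
    by (simp add: C_braid_mixed1 [THEN ccomp_tail3])
  also have "\<dots> = (\<B> \<cdot> \<Theta> (flip s)) \<Zcomp> (\<C> s \<Zcomp> (\<Theta> s \<Zcomp> (\<C> (flip s) \<Zcomp> \<B>)))"
    by (simp only: Tr_App_left Tr_App_right Tr_yank comb_closed ccomp_closed)
  also have "\<dots> = \<B>"
    by (simp add: C_Theta [THEN ccomp_tail2] C_flip [THEN ccomp_tail2] B_cancel [THEN ccomp_tail2])
  finally have rB: "r \<Zcomp> \<B> = \<B>" .
  \<comment> \<open>\<open>rB\<close> now names the equation just proved. It shows that
    \<open>G\<close> with two arguments is plain application, which uniqueness compares with
    \<open>g = \<I>\<close>; then \<open>r = G ; \<B>\<close> is the identity.\<close>
  have "G \<Zcomp> cpow A \<B> (Suc (Suc 0)) = (\<B> \<cdot> \<I>) \<Zcomp> cpow A \<B> (Suc 0)"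
    using GB rB ccomp_assoc [of G \<B> \<B>] by simp
  from arity_0_1_unique [OF G _ _ this] have "G = dot \<I>"
    by simp
  then show ?thesis using GB dot_I_B by (simp add: r_def)
qed

text \<open>The eta law writes the identity as a loop through \<open>\<B>\<close> and
  \<open>\<T>\<close>. Composed in front, \<open>x\<close> slides into the loop and across the
  crossing until it meets \<open>\<B>\<close>; in \<open>Tr_ccomp_cancel\<close> it enters from
  behind and meets \<open>\<T>\<close>.\<close>

lemma ccomp_B_cancel:
  assumes "arity A x (Suc 0) (Suc 0)" "x \<in> carrier A" "x \<Zcomp> \<B> = \<B>"
  shows "x = \<I>"
proof -
  note [simp] = assms(2)
  have "x = x \<Zcomp> \<T> \<cdot> (\<C> Minus \<Zcomp> (\<B> \<Zcomp> (\<T> \<Zcomp> \<C> Plus)))"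
    using Tr_eta [of Plus] by simp
  also have "\<dots> = \<T> \<cdot> (((\<B> \<cdot> x) \<Zcomp> \<C> Minus) \<Zcomp> (\<B> \<Zcomp> (\<T> \<Zcomp> \<C> Plus)))"
    by (simp add: Tr_App_left)
  also have "(\<B> \<cdot> x) \<Zcomp> \<C> Minus = \<C> Minus \<Zcomp> x"
    using sig1_natural [OF assms(1), of Minus] by simp
  also have "\<T> \<cdot> ((\<C> Minus \<Zcomp> x) \<Zcomp> (\<B> \<Zcomp> (\<T> \<Zcomp> \<C> Plus))) = \<I>"
    using Tr_eta [of Plus] by (simp add: assms(3) [THEN ccomp_tail2])
  finally show ?thesis .
qed

lemma Tr_ccomp_cancel:
  assumes "arity A x (Suc 0) (Suc 0)" "x \<in> carrier A" "\<T> \<Zcomp> x = \<T>"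
  shows "x = \<I>"
proof -
  note [simp] = assms(2)
  have "x = \<T> \<cdot> (\<C> Minus \<Zcomp> (\<B> \<Zcomp> (\<T> \<Zcomp> \<C> Plus))) \<Zcomp> x"
    using Tr_eta [of Plus] by simp
  also have "\<dots> = \<T> \<cdot> (\<C> Minus \<Zcomp> (\<B> \<Zcomp> (\<T> \<Zcomp> (\<C> Plus \<Zcomp> (\<B> \<cdot> x)))))"
    by (simp add: Tr_App_right [symmetric])
  also have "\<C> Plus \<Zcomp> (\<B> \<cdot> x) = x \<Zcomp> \<C> Plus"
    using sig1'_natural [OF assms(1), of Plus] by simp
  also have "\<T> \<cdot> (\<C> Minus \<Zcomp> (\<B> \<Zcomp> (\<T> \<Zcomp> (x \<Zcomp> \<C> Plus)))) = \<I>"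
    using Tr_eta [of Plus] by (simp add: assms(3) [THEN ccomp_tail2])
  finally show ?thesis .
qed

text \<open>The twists in \<open>eps\<close> and \<open>eta\<close> cancel the framing that the loops of \<open>eps0\<close> and
  \<open>eta0\<close> produce in \<open>Tr_eps0\<close> and \<open>eta0_B\<close>.\<close>

definition eps0 :: 'a where
  "eps0 = \<T> \<cdot> (\<C> Plus \<Zcomp> ((\<B> \<cdot> \<C> Plus) \<Zcomp> ((\<B> \<cdot> \<B>) \<Zcomp> \<B>)))"

definition eps :: 'a where
  "eps = (\<B> \<cdot> \<Theta> Plus) \<Zcomp> eps0"

definition eta0 :: 'a where
  "eta0 = \<T> \<cdot> (\<T> \<Zcomp> ((\<B> \<cdot> \<T>) \<Zcomp> ((\<B> \<cdot> \<C> Minus) \<Zcomp> \<C> Minus)))"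

definition eta :: 'a where
  "eta = eta0 \<Zcomp> (\<B> \<cdot> \<Theta> Minus)"

lemma eps_closed [simp, intro]: "eps0 \<in> carrier A" "eps \<in> carrier A"
  by (auto simp: eps0_def eps_def)

lemma eta_closed [simp, intro]: "eta0 \<in> carrier A" "eta \<in> carrier A"
  by (auto simp: eta0_def eta_def)

lemma arity_eps: "arity A eps (Suc (Suc 0)) 0"
  unfolding eps_def eps0_def by (rule arity_intros | simp)+

lemma arity_eta: "arity A eta 0 (Suc (Suc 0))"
  unfolding eta_def eta0_def by (rule arity_intros | simp)+

lemma C_cancel [simp]:
  "x \<in> carrier A \<Longrightarrow> \<C> Plus \<Zcomp> (\<C> Minus \<Zcomp> x) = x"
  "x \<in> carrier A \<Longrightarrow> \<C> Minus \<Zcomp> (\<C> Plus \<Zcomp> x) = x"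
  "(\<B> \<cdot> \<C> Plus) \<Zcomp> (\<B> \<cdot> \<C> Minus) = \<I>"
  "(\<B> \<cdot> \<C> Minus) \<Zcomp> (\<B> \<cdot> \<C> Plus) = \<I>"
  "x \<in> carrier A \<Longrightarrow> (\<B> \<cdot> \<C> Plus) \<Zcomp> ((\<B> \<cdot> \<C> Minus) \<Zcomp> x) = x"
  "x \<in> carrier A \<Longrightarrow> (\<B> \<cdot> \<C> Minus) \<Zcomp> ((\<B> \<cdot> \<C> Plus) \<Zcomp> x) = x"
  by (simp_all add: B_cancel B_cancel [THEN ccomp_tail2] C_Plus_Minus [THEN ccomp_tail2])

lemma Theta_cancel [simp]:
  "x \<in> carrier A \<Longrightarrow> \<Theta> Plus \<Zcomp> (\<Theta> Minus \<Zcomp> x) = x"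
  "x \<in> carrier A \<Longrightarrow> \<Theta> Minus \<Zcomp> (\<Theta> Plus \<Zcomp> x) = x"
  "(\<B> \<cdot> \<Theta> Plus) \<Zcomp> (\<B> \<cdot> \<Theta> Minus) = \<I>"
  "(\<B> \<cdot> \<Theta> Minus) \<Zcomp> (\<B> \<cdot> \<Theta> Plus) = \<I>"
  "x \<in> carrier A \<Longrightarrow> (\<B> \<cdot> \<Theta> Plus) \<Zcomp> ((\<B> \<cdot> \<Theta> Minus) \<Zcomp> x) = x"
  "x \<in> carrier A \<Longrightarrow> (\<B> \<cdot> \<Theta> Minus) \<Zcomp> ((\<B> \<cdot> \<Theta> Plus) \<Zcomp> x) = x"
  by (simp_all add: B_cancel B_cancel [THEN ccomp_tail2] Theta_Plus_Minus [THEN ccomp_tail2])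

text \<open>Inside the loop of \<open>eps0\<close> the abstraction is pushed past the crossings
  until it meets an application. The curl left over is the one that \<open>eps\<close>
  compensates.\<close>

lemma Tr_eps0: "\<T> \<Zcomp> ((\<B> \<cdot> \<C> Minus) \<Zcomp> eps0) = (\<B> \<cdot> \<Theta> Minus) \<Zcomp> (\<C> Minus \<Zcomp> \<B>)"
proof -
  have "(\<B> \<cdot> \<T>) \<Zcomp> ((\<B> \<cdot> (\<B> \<cdot> \<C> Minus)) \<Zcomp> (\<C> Plus \<Zcomp> ((\<B> \<cdot> \<C> Plus) \<Zcomp> ((\<B> \<cdot> \<B>) \<Zcomp> \<B>)))) =
      ((\<B> \<cdot> \<T>) \<Zcomp> \<C> Plus) \<Zcomp> ((\<B> \<cdot> (\<B> \<cdot> \<C> Minus)) \<Zcomp> ((\<B> \<cdot> \<C> Plus) \<Zcomp> ((\<B> \<cdot> \<B>) \<Zcomp> \<B>)))"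
    by (simp add: C_commute [THEN ccomp_tail2])
  also have "\<dots> = \<C> Plus \<Zcomp> (\<T> \<Zcomp> (\<B> \<cdot> (\<C> Minus \<Zcomp> ((\<B> \<cdot> \<C> Minus) \<Zcomp> \<C> Plus)) \<Zcomp> ((\<B> \<cdot> \<B>) \<Zcomp> \<B>)))"
    unfolding Tr_C1' by simp
  also have "\<C> Minus \<Zcomp> ((\<B> \<cdot> \<C> Minus) \<Zcomp> \<C> Plus) = (\<B> \<cdot> \<C> Plus) \<Zcomp> (\<C> Minus \<Zcomp> (\<B> \<cdot> \<C> Minus))"
    using C_braid_mixed2 [of Minus] by simp
  also have "\<C> Plus \<Zcomp> (\<T> \<Zcomp> ((\<B> \<cdot> \<dots>) \<Zcomp> ((\<B> \<cdot> \<B>) \<Zcomp> \<B>))) =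
      \<C> Plus \<Zcomp> (\<T> \<Zcomp> ((\<B> \<cdot> (\<B> \<cdot> \<C> Plus)) \<Zcomp> ((\<B> \<cdot> (\<C> Minus \<Zcomp> ((\<B> \<cdot> \<C> Minus) \<Zcomp> \<B>))) \<Zcomp> \<B>)))"
    by simp
  also have "\<C> Minus \<Zcomp> ((\<B> \<cdot> \<C> Minus) \<Zcomp> \<B>) = (\<B> \<cdot> \<B>) \<Zcomp> \<C> Minus"
    by (rule C_B_natural [symmetric])
  also have "\<C> Plus \<Zcomp> (\<T> \<Zcomp> ((\<B> \<cdot> (\<B> \<cdot> \<C> Plus)) \<Zcomp> ((\<B> \<cdot> ((\<B> \<cdot> \<B>) \<Zcomp> \<C> Minus)) \<Zcomp> \<B>))) =
      \<C> Plus \<Zcomp> ((\<B> \<cdot> \<C> Plus) \<Zcomp> ((\<B> \<cdot> \<B>) \<Zcomp> (\<T> \<Zcomp> ((\<B> \<cdot> \<C> Minus) \<Zcomp> \<B>))))"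
    by (simp add: Tr_natural' [THEN ccomp_tail2])
  \<comment> \<open>The abstraction has met its application; beta reduces the pair, and the crossing
    between them becomes a negative curl.\<close>
  also have "\<dots> = \<C> Plus \<Zcomp> (\<B> \<cdot> (\<C> Plus \<Zcomp> (\<B> \<Zcomp> \<Theta> Minus)))"
    unfolding Tr_C_B by simp
  finally have eq: "(\<B> \<cdot> \<T>) \<Zcomp> ((\<B> \<cdot> (\<B> \<cdot> \<C> Minus)) \<Zcomp> (\<C> Plus \<Zcomp> ((\<B> \<cdot> \<C> Plus) \<Zcomp> ((\<B> \<cdot> \<B>) \<Zcomp> \<B>)))) =
      \<C> Plus \<Zcomp> (\<B> \<cdot> (\<C> Plus \<Zcomp> (\<B> \<Zcomp> \<Theta> Minus)))" .
  have "\<T> \<Zcomp> ((\<B> \<cdot> \<C> Minus) \<Zcomp> eps0) = \<T> \<cdot> ((\<B> \<cdot> \<T>) \<Zcomp> ((\<B> \<cdot> (\<B> \<cdot> \<C> Minus)) \<Zcomp>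
      (\<C> Plus \<Zcomp> ((\<B> \<cdot> \<C> Plus) \<Zcomp> ((\<B> \<cdot> \<B>) \<Zcomp> \<B>)))))"
    unfolding eps0_def by (simp add: Tr_App_left)
  \<comment> \<open>The traced wire now runs through a single crossing, so yanking replaces the loop
    by a positive curl.\<close>
  also have "\<dots> = \<Theta> Plus \<Zcomp> (\<C> Plus \<Zcomp> (\<B> \<Zcomp> \<Theta> Minus))"
    unfolding eq by (simp only: Tr_App_right Tr_yank comb_closed ccomp_closed)
  also have "\<dots> = \<Theta> Plus \<Zcomp> ((\<C> Plus \<Zcomp> \<Theta> Minus) \<Zcomp> (\<C> Minus \<Zcomp> (\<Theta> Minus \<Zcomp> (\<C> Minus \<Zcomp> \<B>))))"
    unfolding Theta_B by simp
  also have "\<dots> = \<Theta> Plus \<Zcomp> ((\<B> \<cdot> \<Theta> Minus) \<Zcomp> (\<Theta> Minus \<Zcomp> (\<C> Minus \<Zcomp> \<B>)))"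
    unfolding C_Theta by simp
  also have "\<dots> = (\<B> \<cdot> \<Theta> Minus) \<Zcomp> (\<C> Minus \<Zcomp> \<B>)"
    by (simp add: Theta_natural [THEN ccomp_tail2])
  finally show ?thesis .
qed

text \<open>The counit composed with an abstraction is application up to a crossing. Apart from
  arities, this lemma and \<open>eta_B\<close> are all that the snake equations use of the explicit
  formulas for \<open>eps\<close> and \<open>eta\<close>.\<close>

lemma Tr_eps: "\<T> \<Zcomp> ((\<B> \<cdot> \<C> Minus) \<Zcomp> eps) = \<C> Minus \<Zcomp> \<B>"
proof -
  have *: "(\<B> \<cdot> \<C> Minus) \<Zcomp> (\<B> \<cdot> \<Theta> Plus) = (\<B> \<cdot> (\<B> \<cdot> \<Theta> Plus)) \<Zcomp> (\<B> \<cdot> \<C> Minus)"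
    using arg_cong [OF C_Theta, of "\<lambda>x. \<B> \<cdot> x"] by simp
  have "\<T> \<Zcomp> ((\<B> \<cdot> \<C> Minus) \<Zcomp> eps) =
      (\<T> \<Zcomp> (\<B> \<cdot> (\<B> \<cdot> \<Theta> Plus))) \<Zcomp> ((\<B> \<cdot> \<C> Minus) \<Zcomp> eps0)"
    unfolding eps_def by (simp add: * [THEN ccomp_tail2])
  also have "\<dots> = (\<B> \<cdot> \<Theta> Plus) \<Zcomp> (\<T> \<Zcomp> ((\<B> \<cdot> \<C> Minus) \<Zcomp> eps0))"
    by (simp only: Tr_natural' comb_closed) simp
  also have "\<dots> = \<C> Minus \<Zcomp> \<B>"
    unfolding Tr_eps0 by simp
  finally show ?thesis .
qed

lemma Theta_Tr: "\<Theta> Plus \<Zcomp> \<T> = \<T> \<Zcomp> (\<Theta> Plus \<Zcomp> (\<C> Plus \<Zcomp> (\<Theta> Plus \<Zcomp> \<C> Plus)))"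
  using twist_natural [OF arity_Tr] by (simp add: numeral_2_eq_2 twist_2)

text \<open>The computation dual to \<open>Tr_eps0\<close>: an application is pushed back to an
  abstraction, and naturality of the twist at \<open>\<T>\<close> takes the place of
  \<open>Theta_B\<close>.\<close>

lemma eta0_B: "eta0 \<Zcomp> ((\<B> \<cdot> \<C> Plus) \<Zcomp> \<B>) = \<T> \<Zcomp> (\<C> Plus \<Zcomp> (\<B> \<cdot> \<Theta> Plus))"
proof -
  have "\<T> \<Zcomp> ((\<B> \<cdot> \<T>) \<Zcomp> ((\<B> \<cdot> \<C> Minus) \<Zcomp> (\<C> Minus \<Zcomp> ((\<B> \<cdot> (\<B> \<cdot> \<C> Plus)) \<Zcomp> (\<B> \<cdot> \<B>))))) =
      \<T> \<Zcomp> ((\<B> \<cdot> \<T>) \<Zcomp> ((\<B> \<cdot> \<C> Minus) \<Zcomp> ((\<B> \<cdot> (\<B> \<cdot> \<C> Plus)) \<Zcomp> (\<C> Minus \<Zcomp> (\<B> \<cdot> \<B>)))))"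
    by (simp add: C_commute [THEN ccomp_tail2])
  also have "\<dots> = \<T> \<Zcomp> ((\<B> \<cdot> \<T>) \<Zcomp> ((\<B> \<cdot> (\<C> Minus \<Zcomp> ((\<B> \<cdot> \<C> Plus) \<Zcomp> \<C> Plus))) \<Zcomp> (\<B> \<Zcomp> \<C> Minus)))"
    unfolding C_B_shift by simp
  also have "\<C> Minus \<Zcomp> ((\<B> \<cdot> \<C> Plus) \<Zcomp> \<C> Plus) = (\<B> \<cdot> \<C> Plus) \<Zcomp> (\<C> Plus \<Zcomp> (\<B> \<cdot> \<C> Minus))"
    using C_braid_mixed1 [of Plus] by simp
  also have "\<T> \<Zcomp> ((\<B> \<cdot> \<T>) \<Zcomp> ((\<B> \<cdot> \<dots>) \<Zcomp> (\<B> \<Zcomp> \<C> Minus))) =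
      \<T> \<Zcomp> ((\<B> \<cdot> (\<T> \<Zcomp> ((\<B> \<cdot> \<C> Plus) \<Zcomp> \<C> Plus))) \<Zcomp> (\<B> \<Zcomp> ((\<B> \<cdot> \<C> Minus) \<Zcomp> \<C> Minus)))"
    by (simp add: B_natural [THEN ccomp_tail2])
  also have "\<dots> = \<T> \<Zcomp> ((\<B> \<cdot> \<C> Plus) \<Zcomp> ((\<B> \<cdot> (\<B> \<cdot> \<T>)) \<Zcomp> (\<B> \<Zcomp> ((\<B> \<cdot> \<C> Minus) \<Zcomp> \<C> Minus))))"
    unfolding Tr_C2 by simp
  also have "\<dots> = (\<T> \<Zcomp> ((\<B> \<cdot> \<C> Plus) \<Zcomp> \<B>)) \<Zcomp> ((\<B> \<cdot> \<T>) \<Zcomp> ((\<B> \<cdot> \<C> Minus) \<Zcomp> \<C> Minus))"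
    by (simp add: B_natural [THEN ccomp_tail2])
  also have "\<dots> = (\<B> \<cdot> (\<Theta> Plus \<Zcomp> (\<T> \<Zcomp> \<C> Minus))) \<Zcomp> \<C> Minus"
    unfolding Tr_C_B by simp
  finally have eq: "\<T> \<Zcomp> ((\<B> \<cdot> \<T>) \<Zcomp> ((\<B> \<cdot> \<C> Minus) \<Zcomp> (\<C> Minus \<Zcomp> ((\<B> \<cdot> (\<B> \<cdot> \<C> Plus)) \<Zcomp> (\<B> \<cdot> \<B>))))) =
      (\<B> \<cdot> (\<Theta> Plus \<Zcomp> (\<T> \<Zcomp> \<C> Minus))) \<Zcomp> \<C> Minus" .
  have "eta0 \<Zcomp> ((\<B> \<cdot> \<C> Plus) \<Zcomp> \<B>) = \<T> \<cdot> (\<T> \<Zcomp> ((\<B> \<cdot> \<T>) \<Zcomp> ((\<B> \<cdot> \<C> Minus) \<Zcomp>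
      (\<C> Minus \<Zcomp> ((\<B> \<cdot> (\<B> \<cdot> \<C> Plus)) \<Zcomp> (\<B> \<cdot> \<B>))))))"
    unfolding eta0_def by (simp add: Tr_App_right [symmetric])
  also have "\<dots> = (\<Theta> Plus \<Zcomp> \<T>) \<Zcomp> (\<C> Minus \<Zcomp> \<Theta> Minus)"
    unfolding eq by (simp only: Tr_App_left Tr_yank comb_closed ccomp_closed) simp
  also have "\<dots> = \<T> \<Zcomp> (\<Theta> Plus \<Zcomp> \<C> Plus)"
    unfolding Theta_Tr by simp
  also have "\<dots> = \<T> \<Zcomp> (\<C> Plus \<Zcomp> (\<B> \<cdot> \<Theta> Plus))"
    unfolding Theta_C ..
  finally show ?thesis .
qed

lemma eta_B: "eta \<Zcomp> ((\<B> \<cdot> \<C> Plus) \<Zcomp> \<B>) = \<T> \<Zcomp> \<C> Plus"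
proof -
  have *: "(\<B> \<cdot> \<Theta> Minus) \<Zcomp> (\<B> \<cdot> \<C> Plus) = (\<B> \<cdot> \<C> Plus) \<Zcomp> (\<B> \<cdot> (\<B> \<cdot> \<Theta> Minus))"
    using arg_cong [OF Theta_C, of "\<lambda>x. \<B> \<cdot> x"] by simp
  have "eta \<Zcomp> ((\<B> \<cdot> \<C> Plus) \<Zcomp> \<B>) =
      eta0 \<Zcomp> ((\<B> \<cdot> \<C> Plus) \<Zcomp> ((\<B> \<cdot> (\<B> \<cdot> \<Theta> Minus)) \<Zcomp> \<B>))"
    unfolding eta_def by (simp add: * [THEN ccomp_tail2])
  also have "\<dots> = (eta0 \<Zcomp> ((\<B> \<cdot> \<C> Plus) \<Zcomp> \<B>)) \<Zcomp> (\<B> \<cdot> \<Theta> Minus)"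
    by (simp add: B_natural)
  also have "\<dots> = \<T> \<Zcomp> \<C> Plus"
    unfolding eta0_B by simp
  finally show ?thesis .
qed

subsection \<open>Self-duality of the object 1\<close>

lemma eps_natural: "x \<in> carrier A \<Longrightarrow> eps \<Zcomp> x = (\<B> \<cdot> (\<B> \<cdot> x)) \<Zcomp> eps"
  using interchange [OF arity_eps, of x] by simp

lemma eta_natural: "x \<in> carrier A \<Longrightarrow> eta \<Zcomp> (\<B> \<cdot> (\<B> \<cdot> x)) = x \<Zcomp> eta"
  using interchange [OF arity_eta, of x] by simp

lemma C_B_ccomp_C_eps: "(\<B> \<cdot> \<C> s) \<Zcomp> (\<C> s \<Zcomp> (\<B> \<cdot> eps)) = eps"
  using sig1'_natural [OF arity_eps, of s] by simp

lemma C_ccomp_C_B_eps: "\<C> s \<Zcomp> ((\<B> \<cdot> \<C> s) \<Zcomp> eps) = \<B> \<cdot> eps"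
  using sig1_natural [OF arity_eps, of s] by simp

text \<open>An arrow without inputs has nothing to braid on that side, so it passes from one side of
  a wire to the other at the cost of crossings on its two outputs.\<close>

lemma arity_0_2_C:
  assumes "arity A z 0 (Suc (Suc 0))" "z \<in> carrier A"
  shows "(\<B> \<cdot> z) \<Zcomp> (\<C> s \<Zcomp> (\<B> \<cdot> \<C> s)) = z"
    and "z \<Zcomp> ((\<B> \<cdot> \<C> s) \<Zcomp> \<C> s) = \<B> \<cdot> z"
  using sig1_natural [OF assms, of s] sig1'_natural [OF assms, of s] assms by simp_all

lemmas eta_C = arity_0_2_C [OF arity_eta eta_closed(2)]

text \<open>The first snake equation, compared with the identity after composing with
  \<open>\<B>\<close>. Moving \<open>eps\<close> across a wire brings \<open>\<B>\<close> next to
  \<open>eta\<close>; \<open>eta_B\<close> then produces the abstraction that \<open>Tr_eps\<close>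
  consumes.\<close>

lemma eta_B_eps: "eta \<Zcomp> (\<B> \<cdot> eps) = \<I>"
proof (rule ccomp_B_cancel)
  show "arity A (eta \<Zcomp> (\<B> \<cdot> eps)) (Suc 0) (Suc 0)"
    using arity_right [OF arity_eta, of 1] arity_shift [OF arity_eps] by (auto intro: arity_ccomp)
  have *: "\<B> \<cdot> eps = (\<B> \<cdot> (\<B> \<cdot> \<C> Plus)) \<Zcomp> ((\<B> \<cdot> \<C> Plus) \<Zcomp> (\<B> \<cdot> (\<B> \<cdot> eps)))"
    using arg_cong [OF C_B_ccomp_C_eps [of Plus], of "\<lambda>x. \<B> \<cdot> x"] by simp
  have "(eta \<Zcomp> (\<B> \<cdot> eps)) \<Zcomp> \<B> =
      eta \<Zcomp> ((\<B> \<cdot> (\<B> \<cdot> \<C> Plus)) \<Zcomp> ((\<B> \<cdot> \<C> Plus) \<Zcomp> ((\<B> \<cdot> (\<B> \<cdot> eps)) \<Zcomp> \<B>)))"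
    by (subst *) simp
  also have "\<dots> = \<C> Plus \<Zcomp> ((eta \<Zcomp> ((\<B> \<cdot> \<C> Plus) \<Zcomp> \<B>)) \<Zcomp> (\<B> \<cdot> eps))"
    by (simp add: eta_natural [THEN ccomp_tail2] B_natural)
  also have "\<dots> = \<C> Plus \<Zcomp> (\<T> \<Zcomp> (\<C> Plus \<Zcomp> (\<C> Minus \<Zcomp> ((\<B> \<cdot> \<C> Minus) \<Zcomp> eps))))"
    unfolding eta_B C_ccomp_C_B_eps by simp
  also have "\<dots> = \<B>"
    by (simp add: Tr_eps)
  finally show "(eta \<Zcomp> (\<B> \<cdot> eps)) \<Zcomp> \<B> = \<B>" .
qed simp

text \<open>The second snake equation, compared before composing, with \<open>\<T>\<close> in front;
  now \<open>eta\<close> is the arrow moved across a wire.\<close>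

lemma B_eta_eps: "(\<B> \<cdot> eta) \<Zcomp> eps = \<I>"
proof (rule Tr_ccomp_cancel)
  have "arity A eps (Suc (Suc (Suc 0))) (Suc 0)"
    using arity_right [OF arity_eps, of 1] by simp
  then show "arity A ((\<B> \<cdot> eta) \<Zcomp> eps) (Suc 0) (Suc 0)"
    using arity_shift [OF arity_eta] by (auto intro: arity_ccomp)
  have *: "\<B> \<cdot> eta = (\<B> \<cdot> (\<B> \<cdot> eta)) \<Zcomp> ((\<B> \<cdot> \<C> Minus) \<Zcomp> (\<B> \<cdot> (\<B> \<cdot> \<C> Minus)))"
    using arg_cong [OF eta_C(1) [of Minus], of "\<lambda>x. \<B> \<cdot> x"] by simp
  have "\<T> \<Zcomp> ((\<B> \<cdot> eta) \<Zcomp> eps) =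
      (\<T> \<Zcomp> (\<B> \<cdot> (\<B> \<cdot> eta))) \<Zcomp> ((\<B> \<cdot> \<C> Minus) \<Zcomp> ((\<B> \<cdot> (\<B> \<cdot> \<C> Minus)) \<Zcomp> eps))"
    by (subst *) simp
  also have "\<dots> = (\<B> \<cdot> eta) \<Zcomp> ((\<T> \<Zcomp> ((\<B> \<cdot> \<C> Minus) \<Zcomp> eps)) \<Zcomp> \<C> Minus)"
    by (simp add: Tr_natural' Tr_natural' [THEN ccomp_tail2] eps_natural)
  also have "\<dots> = (eta \<Zcomp> ((\<B> \<cdot> \<C> Plus) \<Zcomp> \<C> Plus)) \<Zcomp> (\<C> Minus \<Zcomp> (\<B> \<Zcomp> \<C> Minus))"
    unfolding Tr_eps eta_C by simp
  also have "\<dots> = (eta \<Zcomp> ((\<B> \<cdot> \<C> Plus) \<Zcomp> \<B>)) \<Zcomp> \<C> Minus"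
    by simp
  also have "\<dots> = \<T>"
    unfolding eta_B by simp
  finally show "\<T> \<Zcomp> ((\<B> \<cdot> eta) \<Zcomp> eps) = \<T>" .
qed simp

text \<open>The bound wire passes \<open>z\<close> with crossings of either sign, and the loop
  becomes a curl of the chosen sign.\<close>

lemma Tr_arity_0_2_B:
  assumes "arity A z 0 (Suc (Suc 0))" "z \<in> carrier A"
  shows "\<T> \<Zcomp> ((\<B> \<cdot> z) \<Zcomp> \<B>) = \<B> \<cdot> (z \<Zcomp> (\<Theta> s \<Zcomp> \<C> s))"
proof -
  note [simp] = assms(2)
  have *: "\<B> \<cdot> z = (\<B> \<cdot> (\<B> \<cdot> z)) \<Zcomp> ((\<B> \<cdot> \<C> s) \<Zcomp> (\<B> \<cdot> (\<B> \<cdot> \<C> s)))"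
    using arg_cong [OF arity_0_2_C(1) [OF assms, of s], of "\<lambda>x. \<B> \<cdot> x"] by simp
  have "\<T> \<Zcomp> ((\<B> \<cdot> z) \<Zcomp> \<B>) =
      \<T> \<Zcomp> ((\<B> \<cdot> (\<B> \<cdot> z)) \<Zcomp> ((\<B> \<cdot> \<C> s) \<Zcomp> ((\<B> \<cdot> (\<B> \<cdot> \<C> s)) \<Zcomp> \<B>)))"
    by (subst *) simp
  also have "\<dots> = (\<B> \<cdot> z) \<Zcomp> ((\<T> \<Zcomp> ((\<B> \<cdot> \<C> s) \<Zcomp> \<B>)) \<Zcomp> (\<B> \<cdot> \<C> s))"
    by (simp add: Tr_natural' [THEN ccomp_tail2] B_natural)
  also have "\<dots> = \<B> \<cdot> (z \<Zcomp> (\<Theta> s \<Zcomp> \<C> s))"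
    unfolding Tr_C_B by simp
  finally show ?thesis .
qed

text \<open>The left-hand side of the previous lemma does not mention the sign; comparing the two signs
  with naturality of the twist lets a twist move across \<open>z\<close>, which is the ribbon condition.\<close>

lemma arity_0_2_Theta:
  assumes "arity A z 0 (Suc (Suc 0))" "z \<in> carrier A"
  shows "z \<Zcomp> (\<B> \<cdot> \<Theta> s) = z \<Zcomp> \<Theta> s"
proof -
  note [simp] = assms(2)
  have 1: "z \<Zcomp> (\<Theta> Plus \<Zcomp> \<C> Plus) = z \<Zcomp> (\<Theta> Minus \<Zcomp> \<C> Minus)"
  proof (rule B_inject)
    show "\<B> \<cdot> (z \<Zcomp> (\<Theta> Plus \<Zcomp> \<C> Plus)) = \<B> \<cdot> (z \<Zcomp> (\<Theta> Minus \<Zcomp> \<C> Minus))"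
      by (simp only: Tr_arity_0_2_B [OF assms, symmetric])
  qed auto
  have 2: "z \<Zcomp> (\<Theta> Plus \<Zcomp> (\<C> Plus \<Zcomp> (\<Theta> Plus \<Zcomp> \<C> Plus))) = z"
    using twist_natural [OF assms] by (simp add: twist_2)
  have "z \<Zcomp> (\<Theta> Plus \<Zcomp> \<C> Plus) =
      (z \<Zcomp> (\<Theta> Plus \<Zcomp> (\<C> Plus \<Zcomp> (\<Theta> Plus \<Zcomp> \<C> Plus)))) \<Zcomp> (\<C> Minus \<Zcomp> \<Theta> Minus)"
    by simp
  also have "\<dots> = z \<Zcomp> ((\<B> \<cdot> \<Theta> Minus) \<Zcomp> \<C> Minus)"
    unfolding 2 C_Theta by simp
  finally have "(z \<Zcomp> ((\<B> \<cdot> \<Theta> Minus) \<Zcomp> \<C> Minus)) \<Zcomp> \<C> Plus = (z \<Zcomp> (\<Theta> Minus \<Zcomp> \<C> Minus)) \<Zcomp> \<C> Plus"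
    unfolding 1 by simp
  then have M: "z \<Zcomp> (\<B> \<cdot> \<Theta> Minus) = z \<Zcomp> \<Theta> Minus"
    by simp
  have "z \<Zcomp> (\<B> \<cdot> \<Theta> Plus) = (z \<Zcomp> \<Theta> Minus) \<Zcomp> ((\<B> \<cdot> \<Theta> Plus) \<Zcomp> \<Theta> Plus)"
    by (simp add: Theta_natural [symmetric])
  also have "\<dots> = z \<Zcomp> \<Theta> Plus"
    unfolding M [symmetric] by simp
  finally show ?thesis using M by (cases s) auto
qed

lemmas eta_Theta = arity_0_2_Theta [OF arity_eta eta_closed(2)]

text \<open>The inverse of \<open>phi\<close>, and the only candidate:
  \<open>psi \<Zcomp> (\<B> \<cdot> eps)\<close> has to be \<open>\<B>\<close>, and the snake
  equations then determine \<open>psi\<close>.\<close>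

definition psi :: 'a where
  "psi = (\<B> \<cdot> eta) \<Zcomp> \<B>"

text \<open>The counit on the other side, in the form braid, twist, \<open>eps\<close> in which it
  closes the loop of \<open>ribbon_trace\<close>.\<close>

definition ev :: 'a where
  "ev = \<C> Plus \<Zcomp> ((\<B> \<cdot> \<Theta> Plus) \<Zcomp> eps)"

text \<open>The reflexive isomorphism from 2 to 1: an abstraction whose second output is absorbed by
  \<open>ev\<close>.\<close>

definition phi :: 'a where
  "phi = \<T> \<Zcomp> (\<B> \<cdot> ev)"

lemma duality_closed [simp, intro]: "psi \<in> carrier A" "ev \<in> carrier A" "phi \<in> carrier A"
  by (auto simp: psi_def ev_def phi_def)

lemma arity_eps': "arity A eps (Suc (Suc n)) n"
  using arity_right [OF arity_eps, of n] by simp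

lemma arity_eta': "arity A eta n (Suc (Suc n))"
  using arity_right [OF arity_eta, of n] by simp

lemma arity_ev: "arity A ev (Suc (Suc n)) n"
  unfolding ev_def by (rule arity_intros arity_eps' | simp)+

lemma arity_psi: "arity A psi (Suc n) (Suc (Suc n))"
  unfolding psi_def by (rule arity_intros arity_eta' | simp)+

lemma arity_phi: "arity A phi (Suc (Suc n)) (Suc n)"
  unfolding phi_def by (rule arity_intros arity_ev | simp)+

lemma C_B_ccomp_C_ev: "(\<B> \<cdot> \<C> s) \<Zcomp> (\<C> s \<Zcomp> (\<B> \<cdot> ev)) = ev"
  using sig1'_natural [OF arity_ev [of 0], of s] by simp

lemma psi_natural: "x \<in> carrier A \<Longrightarrow> psi \<Zcomp> (\<B> \<cdot> (\<B> \<cdot> x)) = (\<B> \<cdot> x) \<Zcomp> psi"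
  using interchange [OF arity_psi [of 0], of x] by simp

lemma phi_natural: "x \<in> carrier A \<Longrightarrow> phi \<Zcomp> (\<B> \<cdot> x) = (\<B> \<cdot> (\<B> \<cdot> x)) \<Zcomp> phi"
  using interchange [OF arity_phi [of 0], of x] by simp

lemma psi_eps: "psi \<Zcomp> (\<B> \<cdot> eps) = \<B>"
proof -
  have "psi \<Zcomp> (\<B> \<cdot> eps) = (\<B> \<cdot> (eta \<Zcomp> (\<B> \<cdot> eps))) \<Zcomp> \<B>"
    by (simp add: psi_def B_natural)
  then show ?thesis by (simp only: eta_B_eps) simp
qed

lemma eta_ev: "eta \<Zcomp> ((\<B> \<cdot> \<C> Minus) \<Zcomp> ((\<B> \<cdot> \<Theta> Minus) \<Zcomp> (\<B> \<cdot> ev))) = \<I>"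
proof -
  have "eta \<Zcomp> ((\<B> \<cdot> \<C> Minus) \<Zcomp> ((\<B> \<cdot> \<Theta> Minus) \<Zcomp> (\<B> \<cdot> ev))) =
      eta \<Zcomp> ((\<B> \<cdot> \<C> Minus) \<Zcomp> ((\<B> \<cdot> (\<Theta> Minus \<Zcomp> \<C> Plus)) \<Zcomp> (\<B> \<cdot> ((\<B> \<cdot> \<Theta> Plus) \<Zcomp> eps))))"
    by (simp add: ev_def)
  also have "\<dots> = eta \<Zcomp> (\<B> \<cdot> (((\<B> \<cdot> \<Theta> Minus) \<Zcomp> (\<B> \<cdot> \<Theta> Plus)) \<Zcomp> eps))"
    unfolding Theta_C by (simp add: B_cancel [THEN ccomp_tail2])
  finally show ?thesis by (simp add: eta_B_eps)
qed

lemma psi_phi: "psi \<Zcomp> phi = \<I>"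
proof (rule ccomp_B_cancel)
  show "arity A (psi \<Zcomp> phi) (Suc 0) (Suc 0)"
    using arity_psi [of 0] arity_phi [of 0] by (auto intro: arity_ccomp)
  have *: "\<B> \<cdot> ev = (\<B> \<cdot> (\<B> \<cdot> \<C> Minus)) \<Zcomp> ((\<B> \<cdot> \<C> Minus) \<Zcomp> (\<B> \<cdot> (\<B> \<cdot> ev)))"
    using arg_cong [OF C_B_ccomp_C_ev [of Minus], of "\<lambda>x. \<B> \<cdot> x"] by simp
  have "(psi \<Zcomp> phi) \<Zcomp> \<B> = (\<B> \<cdot> eta) \<Zcomp> (\<B> \<Zcomp> (\<T> \<Zcomp> ((\<B> \<cdot> ev) \<Zcomp> \<B>)))"
    by (simp add: psi_def phi_def)
  also have "\<dots> = (\<B> \<cdot> eta) \<Zcomp> (\<B> \<Zcomp>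
      (\<T> \<Zcomp> ((\<B> \<cdot> (\<B> \<cdot> \<C> Minus)) \<Zcomp> ((\<B> \<cdot> \<C> Minus) \<Zcomp> ((\<B> \<cdot> (\<B> \<cdot> ev)) \<Zcomp> \<B>)))))"
    by (subst *) simp
  also have "\<dots> = (\<B> \<cdot> eta) \<Zcomp> ((\<B> \<cdot> (\<B> \<cdot> \<C> Minus)) \<Zcomp> (\<B> \<Zcomp>
      ((\<T> \<Zcomp> ((\<B> \<cdot> \<C> Minus) \<Zcomp> \<B>)) \<Zcomp> (\<B> \<cdot> ev))))"
    by (simp add: Tr_natural' [THEN ccomp_tail2] B_natural B_natural [THEN ccomp_tail2])
  also have "\<dots> = (\<B> \<cdot> (eta \<Zcomp> ((\<B> \<cdot> \<C> Minus) \<Zcomp> ((\<B> \<cdot> \<Theta> Minus) \<Zcomp> (\<B> \<cdot> ev))))) \<Zcomp> \<B>"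
    unfolding Tr_C_B by (simp add: B_natural B_natural [THEN ccomp_tail2])
  also have "\<dots> = \<B>"
    unfolding eta_ev by simp
  finally show "(psi \<Zcomp> phi) \<Zcomp> \<B> = \<B>" .
qed simp

lemma Tr_psi: "\<T> \<Zcomp> psi = \<B> \<cdot> (eta \<Zcomp> (\<Theta> Minus \<Zcomp> \<C> Minus))"
  unfolding psi_def by (rule Tr_arity_0_2_B [OF arity_eta]) simp

text \<open>Up to the leg of \<open>eta\<close> that carries the twist, the right side is
  \<open>lam_arrow\<close> built from \<open>eta\<close> and \<open>phi\<close>.\<close>

lemma Tr_eq: "\<T> = (\<B> \<cdot> (eta \<Zcomp> (\<Theta> Minus \<Zcomp> \<C> Minus))) \<Zcomp> phi"
proof -
  have "\<T> = (\<T> \<Zcomp> psi) \<Zcomp> phi" by (simp add: psi_phi)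
  then show ?thesis by (simp only: Tr_psi)
qed

lemma eta_C_eps: "eta \<Zcomp> (\<C> Minus \<Zcomp> ((\<B> \<cdot> \<C> Plus) \<Zcomp> (\<B> \<cdot> eps))) = \<I>"
proof -
  have "\<I> = (eta \<Zcomp> ((\<B> \<cdot> \<C> Plus) \<Zcomp> \<C> Plus)) \<Zcomp>
      ((\<B> \<cdot> \<C> Minus) \<Zcomp> (\<C> Minus \<Zcomp> (\<B> \<cdot> eps)))"
    by (simp only: eta_C C_B_ccomp_C_eps B_eta_eps)
  also have "\<dots> = eta \<Zcomp> (((\<B> \<cdot> \<C> Plus) \<Zcomp> (\<C> Plus \<Zcomp> (\<B> \<cdot> \<C> Minus))) \<Zcomp> (\<C> Minus \<Zcomp> (\<B> \<cdot> eps)))"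
    by simp
  also have "(\<B> \<cdot> \<C> Plus) \<Zcomp> (\<C> Plus \<Zcomp> (\<B> \<cdot> \<C> Minus)) = \<C> Minus \<Zcomp> ((\<B> \<cdot> \<C> Plus) \<Zcomp> \<C> Plus)"
    using C_braid_mixed1 [of Plus] by simp
  finally show ?thesis by simp
qed

lemma phi_psi: "phi \<Zcomp> psi = \<I>"
proof -
  have "phi \<Zcomp> psi = \<T> \<Zcomp> ((\<B> \<cdot> ev) \<Zcomp> psi)"
    by (simp add: phi_def)
  also have "\<dots> = (\<T> \<Zcomp> psi) \<Zcomp> (\<B> \<cdot> (\<B> \<cdot> ev))"
    by (simp add: psi_natural)
  also have "\<dots> = \<B> \<cdot> (eta \<Zcomp> (\<Theta> Minus \<Zcomp> (\<C> Minus \<Zcomp> (\<B> \<cdot> ev))))"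
    unfolding Tr_psi by simp
  also have "eta \<Zcomp> (\<Theta> Minus \<Zcomp> (\<C> Minus \<Zcomp> (\<B> \<cdot> ev))) =
      eta \<Zcomp> (\<Theta> Minus \<Zcomp> (\<C> Minus \<Zcomp> ((\<B> \<cdot> (\<C> Plus \<Zcomp> (\<B> \<cdot> \<Theta> Plus))) \<Zcomp> (\<B> \<cdot> eps))))"
    by (simp add: ev_def)
  also have "\<dots> = eta \<Zcomp> (\<Theta> Minus \<Zcomp> ((\<C> Minus \<Zcomp> (\<B> \<cdot> \<Theta> Plus)) \<Zcomp> ((\<B> \<cdot> \<C> Plus) \<Zcomp> (\<B> \<cdot> eps))))"
    by (simp add: Theta_C [symmetric, THEN ccomp_tail2] Theta_C [symmetric, THEN B_eq, simplified, THEN ccomp_tail2])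
  also have "\<dots> = eta \<Zcomp> (\<C> Minus \<Zcomp> ((\<B> \<cdot> \<C> Plus) \<Zcomp> (\<B> \<cdot> eps)))"
    by (simp add: Theta_C [symmetric, THEN ccomp_tail2] Theta_C [symmetric, THEN B_eq, simplified, THEN ccomp_tail2])
  finally show ?thesis by (simp only: eta_C_eps B_I)
qed

text \<open>In the beta law, \<open>\<T>\<close> is replaced by \<open>Tr_eq\<close> and
  \<open>\<B>\<close> by \<open>psi \<Zcomp> (\<B> \<cdot> eps)\<close>. Sliding \<open>phi\<close>
  past \<open>x\<close> cancels it against \<open>psi\<close> and leaves the loop drawn with
  \<open>eta\<close> and \<open>eps\<close>.\<close>

lemma Tr_App_eq:
  assumes "arity A x (Suc m) (Suc n)" "x \<in> carrier A"
  shows "\<T> \<cdot> x = eta \<Zcomp> (\<Theta> Minus \<Zcomp> (\<C> Minus \<Zcomp> ((\<B> \<cdot> x) \<Zcomp> eps)))"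
proof (rule B_inject)
  note [simp] = assms(2)
  have "\<B> \<cdot> (\<T> \<cdot> x) = ((\<B> \<cdot> (eta \<Zcomp> (\<Theta> Minus \<Zcomp> \<C> Minus))) \<Zcomp> phi) \<Zcomp> ((\<B> \<cdot> x) \<Zcomp> (psi \<Zcomp> (\<B> \<cdot> eps)))"
    unfolding psi_eps Tr_eq [symmetric] Tr_B [OF assms(2)] ..
  also have "\<dots> = (\<B> \<cdot> (eta \<Zcomp> (\<Theta> Minus \<Zcomp> (\<C> Minus \<Zcomp> (\<B> \<cdot> x))))) \<Zcomp> ((phi \<Zcomp> psi) \<Zcomp> (\<B> \<cdot> eps))"
    by (simp add: phi_natural [THEN ccomp_tail2])
  also have "\<dots> = \<B> \<cdot> (eta \<Zcomp> (\<Theta> Minus \<Zcomp> (\<C> Minus \<Zcomp> ((\<B> \<cdot> x) \<Zcomp> eps))))"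
    unfolding phi_psi by simp
  finally show "\<B> \<cdot> (\<T> \<cdot> x) = \<B> \<cdot> (eta \<Zcomp> (\<Theta> Minus \<Zcomp> (\<C> Minus \<Zcomp> ((\<B> \<cdot> x) \<Zcomp> eps))))" .
qed (use assms in auto)

text \<open>Naturality of the twist at \<open>eps\<close>, whose target has trivial twist, trades
  the positive crossing and twist for the negative ones.\<close>

lemma ev_eq: "ev = (\<B> \<cdot> \<Theta> Minus) \<Zcomp> (\<C> Minus \<Zcomp> eps)"
proof -
  have 2: "\<Theta> Plus \<Zcomp> (\<C> Plus \<Zcomp> (\<Theta> Plus \<Zcomp> (\<C> Plus \<Zcomp> eps))) = eps"
    using twist_natural [OF arity_eps] by (simp add: twist_2)
  have "(\<B> \<cdot> \<Theta> Minus) \<Zcomp> (\<C> Minus \<Zcomp> eps) =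
      (\<B> \<cdot> \<Theta> Minus) \<Zcomp> ((\<C> Minus \<Zcomp> \<Theta> Plus) \<Zcomp> (\<C> Plus \<Zcomp> (\<Theta> Plus \<Zcomp> (\<C> Plus \<Zcomp> eps))))"
    by (subst 2 [symmetric]) simp
  also have "\<dots> = (\<Theta> Plus \<Zcomp> \<C> Plus) \<Zcomp> eps"
    unfolding C_Theta by simp
  also have "\<dots> = ev"
    unfolding Theta_C by (simp add: ev_def)
  finally show ?thesis by simp
qed

text \<open>The categorical trace closes the last output, whereas \<open>\<T> \<cdot> _\<close>
  closes the first wire; \<open>\<C> Minus\<close> exchanges the two outputs. The twist moves
  between the legs of \<open>eta\<close> to reach the form of \<open>ev\<close> in
  \<open>ev_eq\<close>.\<close>

lemma ribbon_trace_eq: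
  assumes "arity A f (Suc 0) (Suc (Suc 0))" "f \<in> carrier A"
  shows "eta \<Zcomp> (f \<Zcomp> (\<B> \<cdot> ev)) = \<T> \<cdot> (f \<Zcomp> \<C> Minus)"
proof -
  note [simp] = assms(2)
  have fC: "\<C> Minus \<Zcomp> (\<B> \<cdot> f) = f \<Zcomp> ((\<B> \<cdot> \<C> Minus) \<Zcomp> \<C> Minus)"
    using sig1'_natural [OF assms, of Minus] by simp
  have f2: "f \<Zcomp> (\<B> \<cdot> (\<B> \<cdot> x)) = (\<B> \<cdot> x) \<Zcomp> f" if "x \<in> carrier A" for x
    using interchange [OF assms that] that by simp
  have "arity A (f \<Zcomp> \<C> Minus) (Suc 0) (Suc (Suc 0))"
    using assms arity_C' [of Minus 0] by (auto intro: arity_ccomp)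
  then have "\<T> \<cdot> (f \<Zcomp> \<C> Minus) = eta \<Zcomp> (\<Theta> Minus \<Zcomp> (\<C> Minus \<Zcomp> ((\<B> \<cdot> (f \<Zcomp> \<C> Minus)) \<Zcomp> eps)))"
    by (intro Tr_App_eq) auto
  also have "\<dots> = (eta \<Zcomp> \<Theta> Minus) \<Zcomp> ((\<C> Minus \<Zcomp> (\<B> \<cdot> f)) \<Zcomp> ((\<B> \<cdot> \<C> Minus) \<Zcomp> eps))"
    by simp
  also have "\<dots> = (eta \<Zcomp> (\<B> \<cdot> \<Theta> Minus)) \<Zcomp>
      (f \<Zcomp> ((\<B> \<cdot> \<C> Minus) \<Zcomp> (\<C> Minus \<Zcomp> ((\<B> \<cdot> \<C> Minus) \<Zcomp> eps))))"
    unfolding fC eta_Theta by simp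
  also have "\<dots> = eta \<Zcomp> ((f \<Zcomp> (\<B> \<cdot> (\<B> \<cdot> \<Theta> Minus))) \<Zcomp> ((\<B> \<cdot> \<C> Minus) \<Zcomp> (\<B> \<cdot> eps)))"
    unfolding C_ccomp_C_B_eps f2 [of "\<Theta> Minus", simplified] by simp
  also have "\<dots> = eta \<Zcomp> (f \<Zcomp> (\<B> \<cdot> ev))"
    unfolding ev_eq by simp
  finally show ?thesis ..
qed

lemma twist_Suc_right: "twist (Suc k) = sig1 Plus k \<Zcomp> (twist k \<Zcomp> (sig1' Plus k \<Zcomp> \<Theta> Plus))"
proof -
  have "\<Theta> Plus \<Zcomp> sig1 Plus k = sig1 Plus k \<Zcomp> (cpow A \<B> k \<cdot> \<Theta> Plus)"
    using braid_natural_left [OF arity_Theta, of Plus k] by (simp only: braid_1_left Theta_closed)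
  moreover have "(cpow A \<B> k \<cdot> \<Theta> Plus) \<Zcomp> sig1' Plus k = sig1' Plus k \<Zcomp> \<Theta> Plus"
    using braid_natural_right [OF arity_Theta, of Plus k] by (simp only: braid_1_right Theta_closed)
  moreover have "(cpow A \<B> k \<cdot> \<Theta> Plus) \<Zcomp> twist k = twist k \<Zcomp> (cpow A \<B> k \<cdot> \<Theta> Plus)"
    by (rule interchange [OF arity_twist, symmetric]) auto
  ultimately show ?thesis
    unfolding twist_Suc by (metis Theta_closed App_closed B_closed cpow_closed ccomp_assoc sig1_closed sig1'_closed twist_closed ccomp_closed)
qed

text \<open>The $j$ extra inputs are arguments already supplied: applying the left-hand side for
  \<open>Suc k\<close> to one more argument gives the left-hand side for \<open>k\<close> with
  \<open>sig1' Plus (k + j) \<Zcomp> (\<Theta> Plus \<Zcomp> g)\<close> in place of \<open>g\<close>.\<close>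

lemma Tr_cpow_App_B:
  assumes "arity A g (k + j) (Suc 0)" "g \<in> carrier A"
  shows "\<T> \<cdot> (cpow A \<T> k \<Zcomp> ((\<B> \<cdot> g) \<Zcomp> \<C> Minus)) \<Zcomp> cpow A \<B> k =
    braid j k \<Zcomp> (twist k \<Zcomp> (g \<Zcomp> \<Theta> Minus))"
  using assms
proof (induction k arbitrary: j g)
  case 0
  then show ?case by (simp add: Tr_App_left Tr_yank)
next
  case (Suc k)
  note [simp] = Suc.prems(2)
  let ?R = "sig1' Plus (k + j)"
  have gC: "g \<Zcomp> \<C> Plus = (\<B> \<cdot> ?R) \<Zcomp> (\<C> Plus \<Zcomp> (\<B> \<cdot> g))"
    using sig1'_natural [OF Suc.prems, of Plus] by simp
  define h where "h = ?R \<Zcomp> (\<Theta> Plus \<Zcomp> g)"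
  have [simp]: "h \<in> carrier A" by (simp add: h_def)
  have h: "arity A h (k + Suc j) (Suc 0)"
    unfolding h_def using Suc.prems(1)
    by (auto intro!: arity_ccomp [where m = "Suc (k + j)"] arity_Theta')
  have CB: "\<C> Minus \<Zcomp> (\<B> \<cdot> \<B>) = (\<B> \<cdot> \<C> Plus) \<Zcomp> (\<B> \<Zcomp> \<C> Minus)"
    using C_B_shift [of Minus] by simp
  have "\<T> \<Zcomp> ((\<B> \<cdot> g) \<Zcomp> (\<C> Minus \<Zcomp> (\<B> \<cdot> \<B>))) =
      \<T> \<Zcomp> ((\<B> \<cdot> (g \<Zcomp> \<C> Plus)) \<Zcomp> (\<B> \<Zcomp> \<C> Minus))"
    unfolding CB by simp
  also have "\<dots> = (\<T> \<Zcomp> (\<B> \<cdot> (\<B> \<cdot> ?R))) \<Zcomp> ((\<B> \<cdot> \<C> Plus) \<Zcomp> (((\<B> \<cdot> (\<B> \<cdot> g)) \<Zcomp> \<B>) \<Zcomp> \<C> Minus))"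
    unfolding gC by simp
  also have "\<dots> = (\<B> \<cdot> ?R) \<Zcomp> ((\<T> \<Zcomp> ((\<B> \<cdot> \<C> Plus) \<Zcomp> \<B>)) \<Zcomp> ((\<B> \<cdot> g) \<Zcomp> \<C> Minus))"
    by (simp only: Tr_natural' B_natural [symmetric] sig1'_closed Suc.prems(2)) simp
  also have "\<dots> = (\<B> \<cdot> h) \<Zcomp> \<C> Minus"
    unfolding Tr_C_B h_def by simp
  finally have eq: "\<T> \<Zcomp> ((\<B> \<cdot> g) \<Zcomp> (\<C> Minus \<Zcomp> (\<B> \<cdot> \<B>))) = (\<B> \<cdot> h) \<Zcomp> \<C> Minus" .
  have "\<T> \<cdot> (cpow A \<T> (Suc k) \<Zcomp> ((\<B> \<cdot> g) \<Zcomp> \<C> Minus)) \<Zcomp> cpow A \<B> (Suc k) =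
      (\<T> \<cdot> (cpow A \<T> k \<Zcomp> (\<T> \<Zcomp> ((\<B> \<cdot> g) \<Zcomp> \<C> Minus))) \<Zcomp> \<B>) \<Zcomp> cpow A \<B> k"
    unfolding cpow_Suc_right [OF Tr_closed] by simp
  also have "\<dots> = \<T> \<cdot> (cpow A \<T> k \<Zcomp> (\<T> \<Zcomp> ((\<B> \<cdot> g) \<Zcomp> (\<C> Minus \<Zcomp> (\<B> \<cdot> \<B>))))) \<Zcomp> cpow A \<B> k"
    by (simp add: Tr_App_right [symmetric])
  also have "\<dots> = braid (Suc j) k \<Zcomp> (twist k \<Zcomp> (?R \<Zcomp> (\<Theta> Plus \<Zcomp> (g \<Zcomp> \<Theta> Minus))))"
    unfolding eq using Suc.IH [OF h] by (simp add: h_def)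
  \<comment> \<open>The crossing with the \<open>j\<close> supplied arguments moves to the front and
    completes \<open>braid j (Suc k)\<close>; the crossing with the \<open>k\<close> pending ones
    completes \<open>twist (Suc k)\<close>.\<close>
  also have "?R = (cpow A \<B> k \<cdot> sig1' Plus j) \<Zcomp> sig1' Plus k"
    using braid_add_left [of k j "Suc 0"] by (simp only: braid_1_right)
  also have "braid (Suc j) k \<Zcomp> (twist k \<Zcomp> (\<dots> \<Zcomp> (\<Theta> Plus \<Zcomp> (g \<Zcomp> \<Theta> Minus)))) =
      braid (Suc j) k \<Zcomp> ((twist k \<Zcomp> (cpow A \<B> k \<cdot> sig1' Plus j)) \<Zcomp> (sig1' Plus k \<Zcomp> (\<Theta> Plus \<Zcomp> (g \<Zcomp> \<Theta> Minus))))"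
    by simp
  also have "twist k \<Zcomp> (cpow A \<B> k \<cdot> sig1' Plus j) = (cpow A \<B> k \<cdot> sig1' Plus j) \<Zcomp> twist k"
    by (rule interchange [OF arity_twist]) auto
  also have "braid (Suc j) k \<Zcomp> (\<dots> \<Zcomp> (sig1' Plus k \<Zcomp> (\<Theta> Plus \<Zcomp> (g \<Zcomp> \<Theta> Minus)))) =
      (braid (Suc j) k \<Zcomp> (cpow A \<B> k \<cdot> sig1' Plus j)) \<Zcomp> (twist k \<Zcomp> (sig1' Plus k \<Zcomp> (\<Theta> Plus \<Zcomp> (g \<Zcomp> \<Theta> Minus))))"
    by simp
  also have "braid (Suc j) k \<Zcomp> (cpow A \<B> k \<cdot> sig1' Plus j) = sig1' Plus j \<Zcomp> braid (Suc j) k"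
    by (rule braid_natural_left [symmetric]) auto
  finally show ?case
    unfolding twist_Suc_right by (simp add: braid_Suc_left)
qed

lemma arity_cpow_B: "arity A (cpow A \<B> k) (Suc k) (Suc 0)"
  by (induction k) (auto intro: arity_ccomp arity_B')

lemma arity_cpow_Tr: "arity A (cpow A \<T> k) (Suc 0) (Suc k)"
proof (induction k)
  case (Suc k)
  then show ?case
    unfolding cpow_Suc_right [OF Tr_closed] by (auto intro: arity_ccomp arity_Tr')
qed simp

lemma arity_encode:
  assumes "arity A a m n" "a \<in> carrier A"
  shows "arity A ((\<B> \<cdot> a) \<Zcomp> cpow A \<B> n) (Suc m) (Suc 0)"
    and "arity A (cpow A \<T> (Suc m) \<Zcomp> (\<B> \<cdot> ((\<B> \<cdot> a) \<Zcomp> cpow A \<B> n))) (Suc 0) (Suc (Suc 0))"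
proof -
  show g: "arity A ((\<B> \<cdot> a) \<Zcomp> cpow A \<B> n) (Suc m) (Suc 0)"
    using arity_cpow_B arity_shift [OF assms] assms(2) by (auto intro: arity_ccomp)
  show "arity A (cpow A \<T> (Suc m) \<Zcomp> (\<B> \<cdot> ((\<B> \<cdot> a) \<Zcomp> cpow A \<B> n))) (Suc 0) (Suc (Suc 0))"
    by (rule arity_ccomp [OF arity_cpow_Tr arity_shift [OF g]]) (use assms(2) in auto)
qed

text \<open>Supplying all \<open>Suc m\<close> arguments leaves the body with a twist before it and
  an inverse twist after it, which cancel by naturality. The resulting equation characterises
  \<open>dot a\<close> by extensionality.\<close>

lemma encode_eq_dot:
  assumes "arity A a m n" "a \<in> carrier A"
  shows "\<T> \<cdot> (cpow A \<T> (Suc m) \<Zcomp> ((\<B> \<cdot> ((\<B> \<cdot> a) \<Zcomp> cpow A \<B> n)) \<Zcomp> \<C> Minus)) = dot a"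
proof -
  note [simp] = assms(2)
  let ?g = "(\<B> \<cdot> a) \<Zcomp> cpow A \<B> n"
  let ?F = "\<T> \<cdot> (cpow A \<T> (Suc m) \<Zcomp> ((\<B> \<cdot> ?g) \<Zcomp> \<C> Minus))"
  note g = arity_encode(1) [OF assms]
  have "arity A ((cpow A \<T> (Suc m) \<Zcomp> (\<B> \<cdot> ?g)) \<Zcomp> \<C> Minus) (Suc 0) (Suc (Suc 0))"
    by (rule arity_ccomp [OF arity_encode(2) [OF assms] arity_C']) auto
  then have "arity A (cpow A \<T> (Suc m) \<Zcomp> ((\<B> \<cdot> ?g) \<Zcomp> \<C> Minus)) (Suc 0) (Suc (Suc 0))"
    by simp
  then have F: "arity A ?F 0 (Suc 0)"
    by (intro arity_Tr_App) auto
  have "?F \<Zcomp> cpow A \<B> (Suc m) = braid 0 (Suc m) \<Zcomp> (twist (Suc m) \<Zcomp> (?g \<Zcomp> \<Theta> Minus))"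
    by (rule Tr_cpow_App_B) (use g in auto)
  also have "\<dots> = (twist (Suc m) \<Zcomp> ?g) \<Zcomp> \<Theta> Minus"
    by simp
  also have "twist (Suc m) \<Zcomp> ?g = ?g \<Zcomp> \<Theta> Plus"
    using twist_natural [OF g] by simp
  finally have "?F \<Zcomp> cpow A \<B> (Suc m) = (\<B> \<cdot> a) \<Zcomp> cpow A \<B> n"
    by simp
  from arity_0_1_unique [OF F _ _ this] show ?thesis by simp
qed

subsection \<open>The internal PROB as a ribbon category\<close>

lemma inv_arrow_cat:
  assumes "inverse_arrows cat f g"
  shows "inv_arrow cat f = g"
  unfolding inv_arrow_def
proof (rule the_equality)
  fix h assume h: "inverse_arrows cat f h"
  obtain m a n where f: "f = (m, a, n)" by (cases f)
  obtain b where g: "g = (n, b, m)" "b \<in> carrier A" "a \<in> carrier A" "b \<Zcomp> a = \<I>"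
    using assms f by (cases g) auto
  obtain c where c: "h = (n, c, m)" "c \<in> carrier A" "a \<Zcomp> c = \<I>"
    using h f by (cases h) auto
  have "b = b \<Zcomp> (a \<Zcomp> c)" using g c by simp
  also have "\<dots> = (b \<Zcomp> a) \<Zcomp> c" by (simp only: ccomp_assoc g(2,3) c(2))
  finally show "h = g" using g c by simp
qed (rule assms)

lemma arity_cpow_phi: "arity A (cpow A phi k) (Suc k) (Suc 0)"
  by (induction k) (auto intro: arity_ccomp arity_phi)

lemma arity_cpow_psi: "arity A (cpow A psi k) (Suc 0) (Suc k)"
proof (induction k)
  case (Suc k)
  then show ?case
    unfolding cpow_Suc_right [OF duality_closed(1)] by (auto intro: arity_ccomp arity_psi)
qed simp

lemma cpow_phi_psi: "cpow A phi k \<Zcomp> cpow A psi k = \<I>"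
proof (induction k)
  case (Suc k)
  have "cpow A phi (Suc k) \<Zcomp> cpow A psi (Suc k) = phi \<Zcomp> ((cpow A phi k \<Zcomp> cpow A psi k) \<Zcomp> psi)"
    unfolding cpow_Suc_right [OF duality_closed(1)] by simp
  then show ?case unfolding Suc by (simp add: phi_psi)
qed simp

lemma cpow_psi_phi: "cpow A psi k \<Zcomp> cpow A phi k = \<I>"
proof (induction k)
  case (Suc k)
  have "cpow A psi (Suc k) \<Zcomp> cpow A phi (Suc k) = cpow A psi k \<Zcomp> ((psi \<Zcomp> phi) \<Zcomp> cpow A phi k)"
    unfolding cpow_Suc_right [OF duality_closed(1)] by simp
  then show ?case unfolding psi_phi by (simp add: Suc)
qed simp

text \<open>\<open>cpow A phi k\<close> is an isomorphism from \<open>Suc k\<close> to 1, along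
  which the self-duality of 1 is transported; so 1 is a dual of every nonzero object.\<close>

lemma left_dual_Suc:
  fixes k
  defines "\<eta> \<equiv> (0::nat, eta \<Zcomp> cpow A psi k, Suc k + 1)"
    and "\<epsilon> \<equiv> (1 + Suc k, (\<B> \<cdot> cpow A phi k) \<Zcomp> eps, 0::nat)"
  shows "left_dual cat (Suc k) 1 \<eta> \<epsilon>"
    and "dual_endo cat 1 \<eta> \<epsilon> (Twist cat (Suc k)) = Twist cat 1"
proof -
  let ?p = "cpow A phi k" and ?q = "cpow A psi k"
  have \<eta>: "arity A (eta \<Zcomp> ?q) 0 (Suc (Suc k))"
    using arity_eta arity_right [OF arity_cpow_psi, of k 1] by (auto intro: arity_ccomp)
  have \<epsilon>: "arity A ((\<B> \<cdot> ?p) \<Zcomp> eps) (Suc (Suc k)) 0"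
    using arity_eps arity_shift [OF arity_cpow_phi, of k] by (auto intro: arity_ccomp)
  have "eta \<Zcomp> (?q \<Zcomp> (cpow A \<B> (Suc k) \<cdot> ((\<B> \<cdot> ?p) \<Zcomp> eps))) =
      eta \<Zcomp> ((cpow A \<B> (Suc 0) \<cdot> ((\<B> \<cdot> ?p) \<Zcomp> eps)) \<Zcomp> ?q)"
    by (subst interchange [OF arity_cpow_psi]) auto
  also have "\<dots> = ?p \<Zcomp> ((eta \<Zcomp> (\<B> \<cdot> eps)) \<Zcomp> ?q)"
    by (simp add: eta_natural [THEN ccomp_tail2])
  also have "\<dots> = \<I>"
    unfolding eta_B_eps by (simp add: cpow_phi_psi)
  finally have 1: "eta \<Zcomp> (?q \<Zcomp> (cpow A \<B> (Suc k) \<cdot> ((\<B> \<cdot> ?p) \<Zcomp> eps))) = \<I>" .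
  have 2: "(\<B> \<cdot> (eta \<Zcomp> ?q)) \<Zcomp> ((\<B> \<cdot> ?p) \<Zcomp> eps) = \<I>"
    by (simp add: B_cancel [OF cpow_psi_phi, THEN ccomp_tail2] B_eta_eps)
  show "left_dual cat (Suc k) 1 \<eta> \<epsilon>"
    unfolding left_dual_def \<eta>_def \<epsilon>_def using \<eta> \<epsilon> 1 2 by simp
  have "?q \<Zcomp> twist (Suc k) = \<Theta> Plus \<Zcomp> ?q"
    using twist_natural [OF arity_cpow_psi, of k] by simp
  from B_eq [OF this] have "(\<B> \<cdot> ?q) \<Zcomp> (\<B> \<cdot> twist (Suc k)) = (\<B> \<cdot> \<Theta> Plus) \<Zcomp> (\<B> \<cdot> ?q)"
    by simp
  \<comment> \<open>The twist has passed the isomorphism to the first leg of \<open>eta\<close>.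
    \<open>eta_Theta\<close> moves it to the second leg, from where it slides behind
    \<open>eps\<close>.\<close>
  from ccomp_tail2 [OF this] have "(\<B> \<cdot> (eta \<Zcomp> ?q)) \<Zcomp> ((\<B> \<cdot> twist (Suc k)) \<Zcomp> ((\<B> \<cdot> ?p) \<Zcomp> eps)) =
      (\<B> \<cdot> ((eta \<Zcomp> \<Theta> Plus) \<Zcomp> (?q \<Zcomp> ?p))) \<Zcomp> eps"
    by simp
  also have "\<dots> = (\<B> \<cdot> eta) \<Zcomp> (eps \<Zcomp> \<Theta> Plus)"
    unfolding eta_Theta [symmetric] cpow_psi_phi by (simp add: eps_natural)
  also have "\<dots> = \<Theta> Plus"
    by (simp add: B_eta_eps [THEN ccomp_tail2])
  finally show "dual_endo cat 1 \<eta> \<epsilon> (Twist cat (Suc k)) = Twist cat 1"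
    unfolding dual_endo_def \<eta>_def \<epsilon>_def by simp
qed

lemma left_dual_0:
  "left_dual cat 0 0 (0, \<I>, 0) (0, \<I>, 0)"
  "dual_endo cat 0 (0, \<I>, 0) (0, \<I>, 0) (Twist cat 0) = Twist cat 0"
  by (simp_all add: left_dual_def dual_endo_def)

lemma ribbon_category_cat: "ribbon_category cat"
proof -
  interpret braided_strict_monoidal_category cat by (rule braided_cat)
  show ?thesis
  proof
    fix X Y
    show "Twist cat X \<in> hom cat X X"
      by (simp add: arity_twist)
    have "inverse_arrows cat (Twist cat X) (X, twist_inv X, X)"
      by (simp add: arity_twist arity_twist_inv twist_twist_inv twist_inv_twist)
    then show "iso_arrow cat (Twist cat X)"
      unfolding iso_arrow_def by blast
    show "Twist cat (TensO cat X Y) =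
        Seq cat (Seq cat (Braid cat X Y) (TensM cat (Twist cat Y) (Twist cat X))) (Braid cat Y X)"
      by (simp add: twist_add)
    show "\<exists>D \<eta> \<epsilon>. left_dual cat X D \<eta> \<epsilon> \<and> dual_endo cat D \<eta> \<epsilon> (Twist cat X) = Twist cat D"
      using left_dual_0 left_dual_Suc by (cases X) blast+
  next
    fix f X Y
    assume "f \<in> hom cat X Y"
    then show "Seq cat f (Twist cat Y) = Seq cat (Twist cat X) f"
      by (auto elim!: hom_catE simp: twist_natural)
  qed
qed

section \<open>The reflexive object 1 and its combinatory algebra\<close>

abbreviation cat_eta where "cat_eta \<equiv> (0::nat, eta, Suc (Suc 0))"
abbreviation cat_eps where "cat_eps \<equiv> (Suc (Suc 0), eps, 0::nat)"
abbreviation cat_phi where "cat_phi \<equiv> (Suc (Suc 0), phi, Suc 0)"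

lemma inverse_phi: "inverse_arrows cat cat_phi (Suc 0, psi, Suc (Suc 0))"
  using arity_phi [of 0] arity_psi [of 0] by (simp add: numeral_2_eq_2 phi_psi psi_phi)

lemma reflexive_object_cat: "reflexive_object cat (Suc 0) (Suc 0) cat_eta cat_eps cat_phi"
proof -
  have "left_dual cat (Suc 0) (Suc 0) cat_eta cat_eps"
    using left_dual_Suc(1) [of 0] by (simp add: numeral_2_eq_2)
  then show ?thesis
    using inverse_phi arity_phi [of 0]
    unfolding reflexive_object_def iso_arrow_def by (auto simp: numeral_2_eq_2)
qed

lemma inv_arrow_phi: "inv_arrow cat cat_phi = (Suc 0, psi, Suc (Suc 0))"
  by (rule inv_arrow_cat [OF inverse_phi])

lemma inv_arrow_braid: "inv_arrow cat (Braid cat (Suc 0) (Suc 0)) = (Suc (Suc 0), \<C> Minus, Suc (Suc 0))"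
  using arity_C' [of Plus 0] arity_C' [of Minus 0]
  by (intro inv_arrow_cat) (simp add: numeral_2_eq_2)

lemma inv_arrow_twist: "inv_arrow cat (Twist cat (Suc 0)) = (Suc 0, \<Theta> Minus, Suc 0)"
  by (intro inv_arrow_cat) simp

lemma app_arrow_cat: "app_arrow cat (Suc 0) cat_eps cat_phi = (Suc (Suc 0), \<B>, Suc 0)"
  unfolding app_arrow_def inv_arrow_phi using psi_eps by simp

lemma lam_arrow_cat: "lam_arrow cat (Suc 0) (Suc 0) cat_eta cat_phi = (Suc 0, \<T>, Suc (Suc 0))"
proof -
  \<comment> \<open>\<open>lam_arrow\<close> twists the dual leg of the unit, \<open>Tr_eq\<close>
    the other one.\<close>
  have "\<T> = (\<B> \<cdot> ((eta \<Zcomp> (\<B> \<cdot> \<Theta> Minus)) \<Zcomp> \<C> Minus)) \<Zcomp> phi"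
    unfolding eta_Theta by (subst Tr_eq) simp
  then show ?thesis
    unfolding lam_arrow_def inv_arrow_braid inv_arrow_twist by simp
qed

lemma TensO_pow_cat: "TensO_pow cat (Suc 0) n = n"
  by (induction n) auto

lemma app_pow_cat: "app_pow cat (Suc 0) cat_eps cat_phi n = (Suc n, cpow A \<B> n, Suc 0)"
  by (induction n) (auto simp: app_arrow_cat TensO_pow_cat)

lemma lam_pow_cat: "lam_pow cat (Suc 0) (Suc 0) cat_eta cat_phi n = (Suc 0, cpow A \<T> n, Suc n)"
  by (induction n) (auto simp: lam_arrow_cat TensO_pow_cat cpow_Suc_right simp del: cpow.simps(2))

lemma encode_cat:
  assumes "arity A a m n" "a \<in> carrier A"
  shows "encode cat (Suc 0) (Suc 0) cat_eta cat_eps cat_phi m n (m, a, n) = (0, dot a, Suc 0)"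
proof -
  note [simp] = assms(2)
  let ?f = "cpow A \<T> (Suc m) \<Zcomp> (\<B> \<cdot> ((\<B> \<cdot> a) \<Zcomp> cpow A \<B> n))"
  have "eta \<Zcomp> (?f \<Zcomp> (\<B> \<cdot> ev)) = \<T> \<cdot> (?f \<Zcomp> \<C> Minus)"
    by (rule ribbon_trace_eq [OF arity_encode(2) [OF assms]]) auto
  also have "\<dots> = dot a"
    using encode_eq_dot [OF assms] by simp
  finally show ?thesis
    unfolding encode_def ribbon_trace_def lam_pow_cat app_pow_cat lam_arrow_cat
    unfolding ev_def cpow_Suc_right [OF Tr_closed]
    by (simp add: numeral_2_eq_2)
qed

text \<open>\<open>dot a\<close> returns \<open>a\<close> when applied to \<open>\<I>\<close>, and
  \<open>arity_0_1_eq_dot\<close> gives surjectivity. Each constant is matched by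
  \<open>encode_cat\<close> at the arrow that it encodes.\<close>

lemma comb_alg_iso_dot:
  "comb_alg_iso (\<lambda>a. (0, dot a, Suc 0)) A (reflexive_comb_alg cat (Suc 0) (Suc 0) cat_eta cat_eps cat_phi)"
proof -
  let ?R = "reflexive_comb_alg cat (Suc 0) (Suc 0) cat_eta cat_eps cat_phi"
  have inj: "inj_on dot (carrier A)"
    by (rule inj_onI) (metis dot_App I_app I_closed)
  have "bij_betw (\<lambda>a. (0, dot a, Suc 0)) (carrier A) (carrier ?R)"
    unfolding bij_betw_def
  proof
    show "inj_on (\<lambda>a. (0::nat, dot a, Suc 0)) (carrier A)"
      using inj by (auto simp: inj_on_def)
    show "(\<lambda>a. (0, dot a, Suc 0)) ` carrier A = carrier ?R"
    proof
      show "(\<lambda>a. (0, dot a, Suc 0)) ` carrier A \<subseteq> carrier ?R"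
        by (auto simp: reflexive_comb_alg_def)
      show "carrier ?R \<subseteq> (\<lambda>a. (0, dot a, Suc 0)) ` carrier A"
      proof
        fix f assume "f \<in> carrier ?R"
        then obtain a where a: "f = (0, a, Suc 0)" "a \<in> carrier A" "arity A a 0 (Suc 0)"
          by (auto simp: reflexive_comb_alg_def elim!: hom_catE)
        then have "a = dot (a \<cdot> \<I>)"
          by (intro arity_0_1_eq_dot)
        then show "f \<in> (\<lambda>a. (0, dot a, Suc 0)) ` carrier A"
          using a by (intro image_eqI [where x = "a \<cdot> \<I>"]) auto
      qed
    qed
  qed
  moreover have "(0, dot (a \<cdot> b), Suc 0) = (0, dot a, Suc 0) \<cdot>\<^bsub>?R\<^esub> (0, dot b, Suc 0)"
    if "a \<in> carrier A" "b \<in> carrier A" for a b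
    using that dot_natural [of a "dot b", THEN ccomp_tail2]
    by (simp add: reflexive_comb_alg_def app_arrow_cat dot_of_App dot_natural)
  moreover have "(0, dot \<B>, Suc 0) = \<B>\<^bsub>?R\<^esub>"
    using encode_cat [OF arity_B] by (simp add: reflexive_comb_alg_def app_arrow_cat numeral_2_eq_2)
  moreover have "(0, dot (\<C> s), Suc 0) = \<C>\<^bsub>?R\<^esub> s" for s
    using encode_cat [OF arity_C [of s]] inv_arrow_braid
    by (cases s) (simp_all add: reflexive_comb_alg_def numeral_2_eq_2)
  moreover have "(0, dot \<I>, Suc 0) = \<I>\<^bsub>?R\<^esub>"
    using encode_cat [OF arity_I [of 0]] by (simp add: reflexive_comb_alg_def)
  moreover have "(0, dot (\<Theta> s), Suc 0) = \<Theta>\<^bsub>?R\<^esub> s" for s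
    using encode_cat [OF arity_Theta [of s]] inv_arrow_twist
    by (cases s) (simp_all add: reflexive_comb_alg_def)
  moreover have "(0, dot \<T>, Suc 0) = \<T>\<^bsub>?R\<^esub>"
    using encode_cat [OF arity_Tr] by (simp add: reflexive_comb_alg_def lam_arrow_cat numeral_2_eq_2)
  ultimately show ?thesis
    unfolding comb_alg_iso_def by blast
qed

end

theorem theorem6p1:
  fixes A :: "('a, 'x) comb_alg_scheme"
  assumes "ribbon_combinatory_algebra A"
  shows "ribbon_category (internal_prob A) \<and>
    (\<exists>D \<eta> \<epsilon> \<phi>. reflexive_object (internal_prob A) 1 D \<eta> \<epsilon> \<phi> \<and>
      comb_alg_isomorphic A (reflexive_comb_alg (internal_prob A) 1 D \<eta> \<epsilon> \<phi>))"
proof -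
  interpret ribbon_combinatory_algebra A by (rule assms)
  show ?thesis
    using ribbon_category_cat reflexive_object_cat comb_alg_iso_dot
    unfolding comb_alg_isomorphic_def cat_def One_nat_def by blast
qed

end
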